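(* Suppose $k_1=2$ and $2\le t\le\min\{k_2,d\}$. If $\emptyset\ne S\subseteq[2]\times[k_2]$ is minimal of combinatorial type $(u,v)$, where $S=\{1\}\times\{1,\dots,u\}\,\cup\,\{2\}\times\{k_2-v+1,\dots,k_2\}$, then the set $$F(J_S)=\bigcup_{j\in[k_2],\,C_j\cap S=\emptyset}F_2(X_{C_j})\cup F_{t-1}(X_{\mathcal C(S)})\cup F_t(X_{(R_1\setminus S)\cup\mathcal C(S)})\cup F_t(X_{(R_2\setminus S)\cup\mathcal C(S)})$$ is a Gröbner basis, with respect to the term order $\prec$, for the ideal $J_S$ it generates.
   Context: Let $k_2,d,t$ be integers with $2\le t\le\min\{k_2,d\}$; $[n]=\{1,\dots,n\}$. Let $X=(x_{i(j,\ell)})$ be the $d\times 2k_2$ matrix of indeterminates with rows $i\in[d]$ and columns $(j,\ell)\in[2]\times[k_2]$, and $\mathbb C[X]$ the polynomial ring over $\mathbb C$ in its entries. For $U\subseteq[2]\times[k_2]$, $X_U$ is the submatrix of $X$ with columns in $U$. For a submatrix $Y$ of $X$, $F_r(Y)$ is the set of $r$-minors of $Y$. Put $R_i=\{i\}\times[k_2]$, $C_j=[2]\times\{j\}$, and let $\mathcal C(S)$ be the union of all $C_j$ with $C_j\cap S=\emptyset$. If $S$ contains no $C_j$, its combinatorial type is $(u,v)$ with $u=\min\{|R_1\cap S|,|R_2\cap S|\}$, $v=\max\{|R_1\cap S|,|R_2\cap S|\}$. A nonempty $S$ is called minimal if: $C_j\not\subseteq S$ for all $j\in[k_2]$; $1\le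 u\le v\le k_2-t+1$; and, if $t=2$, additionally $u+v=k_2$. The term order $\prec$ is the lexicographic order with respect to $x_{1(1,1)}>x_{2(1,1)}>\cdots>x_{d(1,1)}>x_{1(2,1)}>\cdots>x_{d(2,1)}>x_{1(1,2)}>\cdots>x_{d(2,k_2)}$, i.e. columns of $X$ are ordered $(1,1),(2,1),(1,2),(2,2),\dots,(1,k_2),(2,k_2)$ and within each column variables are ordered by increasing row index. *)

theory Defs
  imports
    Complex_Main
    "HOL-Library.Poly_Mapping"
    "HOL-Library.Product_Lexorder"
    "HOL-Algebra.Ideal"
    "Jordan_Normal_Form.Determinant"
    "Jordan_Normal_Form.DL_Submatrix"
begin

text \<open>
  Monomials are finitely supported exponent functions. The polynomials form a type in
  which every element of \<open>'v\<close> is an indeterminate, so a polynomial ring in a prescribed set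
  \<open>V\<close> of indeterminates is a carrier inside that type.
\<close>

type_synonym 'v mpoly = "('v \<Rightarrow>\<^sub>0 nat) \<Rightarrow>\<^sub>0 complex"

definition poly_ring :: "'v set \<Rightarrow> 'v mpoly ring" where
  "poly_ring V =
    \<lparr>carrier = {p. \<forall>m \<in> Poly_Mapping.keys p. Poly_Mapping.keys m \<subseteq> V},
     monoid.mult = (*), one = 1, zero = 0, add = (+)\<rparr>"

lemma cring_poly_ring: "cring (poly_ring V)"
proof -
  let ?R = "poly_ring V"
  have sel: "(\<otimes>\<^bsub>?R\<^esub>) = (*)" "(\<oplus>\<^bsub>?R\<^esub>) = (+)" "\<one>\<^bsub>?R\<^esub> = 1" "\<zero>\<^bsub>?R\<^esub> = 0"
    by (simp_all add: poly_ring_def)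
  have mem: "p \<in> carrier ?R \<longleftrightarrow> (\<forall>m \<in> Poly_Mapping.keys p. Poly_Mapping.keys m \<subseteq> V)" for p
    by (simp add: poly_ring_def)
  have add: "p + q \<in> carrier ?R" if "p \<in> carrier ?R" "q \<in> carrier ?R" for p q
    using that Poly_Mapping.keys_add[of p q] unfolding mem by blast
  have mult: "p * q \<in> carrier ?R" if p: "p \<in> carrier ?R" and q: "q \<in> carrier ?R" for p q
    unfolding mem
  proof
    fix m assume "m \<in> Poly_Mapping.keys (p * q)"
    then obtain a b where m: "m = a + b" "a \<in> Poly_Mapping.keys p" "b \<in> Poly_Mapping.keys q"
      using Poly_Mapping.keys_mult[of p q] by blast
    then have "Poly_Mapping.keys a \<subseteq> V" "Poly_Mapping.keys b \<subseteq> V"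
      using p q unfolding mem by blast+
    then show "Poly_Mapping.keys m \<subseteq> V"
      using Poly_Mapping.keys_add[of a b] m(1) by blast
  qed
  have uminus: "- p \<in> carrier ?R" if "p \<in> carrier ?R" for p
    using that unfolding mem by simp
  have zero: "0 \<in> carrier ?R" and one: "1 \<in> carrier ?R"
    unfolding mem by simp_all
  show ?thesis
  proof (rule cringI)
    show "abelian_group ?R"
    proof (rule abelian_groupI, unfold sel)
      fix p q r
      assume "p \<in> carrier ?R"
      then show "\<exists>q \<in> carrier ?R. q + p = 0"
        by (intro bexI[of _ "- p"] uminus left_minus)
      show "p + q + r = p + (q + r)" "p + q = q + p" "0 + p = p"
        by (rule add.assoc add.commute add_0_left)+
    qed (rule zero add; assumption)+
    show "comm_monoid ?R"
    proof (rule comm_monoidI, unfold sel)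
      fix p q r :: "'a mpoly"
      show "p * q * r = p * (q * r)" "p * q = q * p" "1 * p = p"
        by (rule mult.assoc mult.commute mult_1_left)+
    qed (rule one mult; assumption)+
    show "(p \<oplus>\<^bsub>?R\<^esub> q) \<otimes>\<^bsub>?R\<^esub> r = p \<otimes>\<^bsub>?R\<^esub> r \<oplus>\<^bsub>?R\<^esub> q \<otimes>\<^bsub>?R\<^esub> r" for p q r
      unfolding sel by (rule distrib_right)
  qed
qed

text \<open>
  The term order is the library's linear order on monomials, i.e. the lexicographic order in
  which \<open>x\<^sub>a > x\<^sub>b\<close> iff \<open>a < b\<close> in \<open>'v\<close>.
\<close>

lemma less_monomial_iff:
  fixes m m' :: "('v::linorder) \<Rightarrow>\<^sub>0 nat"
  shows "m < m' \<longleftrightarrow>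
    (\<exists>a. Poly_Mapping.lookup m a < Poly_Mapping.lookup m' a \<and>
         (\<forall>b<a. Poly_Mapping.lookup m b = Poly_Mapping.lookup m' b))"
  by (simp add: less_poly_mapping.rep_eq less_fun_def)

definition initial_monomial :: "('v::linorder) mpoly \<Rightarrow> 'v mpoly" where
  "initial_monomial p = Poly_Mapping.single (Max (Poly_Mapping.keys p)) 1"

definition initial_ideal :: "('v::linorder) set \<Rightarrow> 'v mpoly set \<Rightarrow> 'v mpoly set" where
  "initial_ideal V I = Idl\<^bsub>poly_ring V\<^esub> (initial_monomial ` (I - {0}))"

definition is_groebner_basis ::
    "('v::linorder) set \<Rightarrow> 'v mpoly set \<Rightarrow> 'v mpoly set \<Rightarrow> bool" where
  "is_groebner_basis V G I \<longleftrightarrow>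
     finite G \<and> G \<subseteq> I \<and> Idl\<^bsub>poly_ring V\<^esub> (initial_monomial ` (G - {0})) = initial_ideal V I"

text \<open>
  The indeterminate \<open>x\<^bsub>i(j,l)\<^esub>\<close> is indexed by the triple \<open>(l, j, i)\<close>. With the lexicographic
  order on triples, the term order above becomes the one with
  \<open>x\<^bsub>1(1,1)\<^esub> > \<dots> > x\<^bsub>d(1,1)\<^esub> > x\<^bsub>1(2,1)\<^esub> > \<dots> > x\<^bsub>d(2,1)\<^esub> > x\<^bsub>1(1,2)\<^esub> > \<dots>\<close>.
\<close>

type_synonym idx = "nat \<times> nat \<times> nat"

lemma less_idx_iff:
  "((l, j, i) :: idx) < (l', j', i') \<longleftrightarrow> l < l' \<or> l = l' \<and> (j < j' \<or> j = j' \<and> i < i')"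
  by auto

definition indet :: "nat \<Rightarrow> nat \<times> nat \<Rightarrow> idx mpoly" where
  "indet i = (\<lambda>(j, l). Poly_Mapping.single (Poly_Mapping.single (l, j, i) 1) 1)"

definition indets :: "nat \<Rightarrow> nat \<Rightarrow> idx set" where
  "indets d k2 = {1..k2} \<times> {1..2} \<times> {1..d}"

text \<open>
  Matrices are indexed from 0, and \<open>col_pos\<close> lists the columns in the order
  \<open>(1,1), (2,1), (1,2), (2,2), \<dots>\<close>; see \<open>generic_matrix_entry\<close>.
\<close>

definition col_pos :: "nat \<times> nat \<Rightarrow> nat" where
  "col_pos = (\<lambda>(j, l). 2 * (l - 1) + (j - 1))"

definition generic_matrix :: "nat \<Rightarrow> nat \<Rightarrow> idx mpoly mat" where
  "generic_matrix d k2 = mat d (2 * k2) (\<lambda>(a, b). indet (a + 1) (b mod 2 + 1, b div 2 + 1))"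

lemma generic_matrix_entry:
  assumes "i \<in> {1..d}" "c \<in> {1..2} \<times> {1..k2}"
  shows "generic_matrix d k2 $$ (i - 1, col_pos c) = indet i c"
proof -
  obtain j l where c: "c = (j, l)" "j = 1 \<or> j = 2" "1 \<le> l" "l \<le> k2"
    using assms(2) by (cases c) force
  then have "col_pos c < 2 * k2" "col_pos c mod 2 + 1 = j" "col_pos c div 2 + 1 = l"
    by (auto simp: col_pos_def)
  then show ?thesis
    using assms(1) c by (auto simp: generic_matrix_def numeral_2_eq_2)
qed

definition cols_submatrix :: "nat \<Rightarrow> nat \<Rightarrow> (nat \<times> nat) set \<Rightarrow> idx mpoly mat" where
  "cols_submatrix d k2 U = submatrix (generic_matrix d k2) UNIV (col_pos ` U)"

definition minors :: "nat \<Rightarrow> 'a::comm_ring_1 mat \<Rightarrow> 'a set" where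
  "minors r Y = {det (submatrix Y I J) | I J.
     I \<subseteq> {..<dim_row Y} \<and> J \<subseteq> {..<dim_col Y} \<and> card I = r \<and> card J = r}"

definition row_set :: "nat \<Rightarrow> nat \<Rightarrow> (nat \<times> nat) set" where
  "row_set k2 i = {i} \<times> {1..k2}"

definition col_set :: "nat \<Rightarrow> (nat \<times> nat) set" where
  "col_set j = {1..2} \<times> {j}"

definition free_cols :: "nat \<Rightarrow> (nat \<times> nat) set \<Rightarrow> (nat \<times> nat) set" where
  "free_cols k2 S = \<Union> {col_set j | j. j \<in> {1..k2} \<and> col_set j \<inter> S = {}}"

text \<open>Only meaningful for sets \<open>S\<close> that contain no \<open>col_set j\<close>.\<close>

definition comb_type :: "nat \<Rightarrow> (nat \<times> nat) set \<Rightarrow> nat \<times> nat" where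
  "comb_type k2 S =
    (min (card (row_set k2 1 \<inter> S)) (card (row_set k2 2 \<inter> S)),
     max (card (row_set k2 1 \<inter> S)) (card (row_set k2 2 \<inter> S)))"

definition minimal :: "nat \<Rightarrow> nat \<Rightarrow> (nat \<times> nat) set \<Rightarrow> bool" where
  "minimal k2 t S \<longleftrightarrow>
     S \<noteq> {} \<and> (\<forall>j \<in> {1..k2}. \<not> col_set j \<subseteq> S) \<and>
     (case comb_type k2 S of (u, v) \<Rightarrow>
        1 \<le> u \<and> u \<le> v \<and> v \<le> k2 - t + 1 \<and> (t = 2 \<longrightarrow> u + v = k2))"

definition F_J :: "nat \<Rightarrow> nat \<Rightarrow> nat \<Rightarrow> (nat \<times> nat) set \<Rightarrow> idx mpoly set" where
  "F_J d k2 t S =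
     (\<Union>j \<in> {j \<in> {1..k2}. col_set j \<inter> S = {}}. minors 2 (cols_submatrix d k2 (col_set j)))
     \<union> minors (t - 1) (cols_submatrix d k2 (free_cols k2 S))
     \<union> minors t (cols_submatrix d k2 ((row_set k2 1 - S) \<union> free_cols k2 S))
     \<union> minors t (cols_submatrix d k2 ((row_set k2 2 - S) \<union> free_cols k2 S))"

definition J_ideal :: "nat \<Rightarrow> nat \<Rightarrow> nat \<Rightarrow> (nat \<times> nat) set \<Rightarrow> idx mpoly set" where
  "J_ideal d k2 t S = Idl\<^bsub>poly_ring (indets d k2)\<^esub> (F_J d k2 t S)"

end

theory Submission
  imports Defs
begin

text \<open>
  Order the columns as in the term order and ignore the columns in \<open>S\<close>. The columns that are left
  form three consecutive groups \<open>L\<close>, \<open>M\<close>, \<open>N\<close>, where \<open>M\<close> consists of the pairs \<open>C\<^sub>j\<close> that avoid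
  \<open>S\<close>, \<open>L\<close> is the rest of \<open>R\<^sub>2 - S\<close> and \<open>N\<close> is the rest of \<open>R\<^sub>1 - S\<close>. Each of the four families of
  generators consists of all minors of one size in an interval of columns: a single pair in \<open>M\<close>,
  all of \<open>M\<close>, \<open>L\<close> with \<open>M\<close>, or \<open>M\<close> with \<open>N\<close>. The theorem therefore follows from a general fact,
  \<open>interval_minors_groebner\<close>: for any finite set of conditions of the form ``the columns in the
  interval \<open>[a, e)\<close> have rank at most \<open>r\<close>'', the \<open>(r + 1)\<close>-minors of all these intervals together
  form a Groebner basis.

  The leading monomial of a minor is the product of its main diagonal. An element of the ideal
  vanishes at every complex matrix that satisfies the rank conditions. Hence it suffices to prove:
  if a nonzero polynomial \<open>p\<close> vanishes at all these matrices, then its leading monomial is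
  divisible by the main diagonal of one of the minors. Only matrices and limits are needed for
  this; ideals appear again only at the very end.

  The proof removes one variable at a time, from the largest on. Let \<open>y\<close> be the largest variable
  left, in column \<open>c\<close> and row \<open>k\<close>, and write a block of a rank condition with \<open>y\<close> in its corner as
  \<open>(y, a; b, B)\<close>, with \<open>a\<close> the rest of its first row and \<open>b\<close> the rest of its first column. The
  matrix \<open>(y, a; b, B + b a / y)\<close> has rank \<open>1 + rank B\<close>.

  If \<open>y\<close> divides the leading monomial of \<open>p\<close>, let \<open>y\<close> tend to infinity along this curve: the
  coefficient of the highest power of \<open>y\<close> in \<open>p\<close> vanishes at all matrices with \<open>rank B \<le> r - 1\<close>.
  By induction its leading monomial is divisible by a diagonal, and if this diagonal has length
  \<open>r\<close> and lies in \<open>B\<close>, the variable \<open>y\<close> prolongs it to one of length \<open>r + 1\<close>.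

  Otherwise \<open>p\<close> does not involve \<open>y\<close>, because the order is lexicographic, and the block condition
  can be replaced by the two conditions \<open>rank (a; B) \<le> r\<close> and \<open>rank (b, B) \<le> r\<close>. A matrix that
  satisfies these either can be completed by a suitable value of \<open>y\<close>, or is a limit of matrices
  that can: in the second case \<open>rank B \<le> r - 1\<close> and the same curve does it (\<open>corner_completion\<close>).

  Several conditions have \<open>y\<close> in their corner at the same time. The curve treats all of them at
  once, because it can be performed in all columns to the right of \<open>c\<close> simultaneously. It is then
  a row operation on every block that contains row \<open>k\<close> and lies to the right of column \<open>c\<close>, and a
  column operation on every block that starts with column \<open>c\<close> and lies below row \<open>k\<close>; so it
  preserves all other conditions. The conditions that occur in the course of the induction are
  therefore blocks of three shapes, which \<open>admissible\<close> lists.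
\<close>

section \<open>Matrices of bounded rank\<close>

text \<open>
  The Fredholm alternative: a vector outside the span of the rows of \<open>B\<close> is separated from them by
  a vector in their kernel.
\<close>

lemma span_or_separated:
  fixes a :: "'c \<Rightarrow> 'f::field" and B :: "'r \<Rightarrow> 'c \<Rightarrow> 'f"
  assumes "finite R" "finite C"
  shows "(\<exists>z. \<forall>c\<in>C. a c = (\<Sum>i\<in>R. z i * B i c)) \<or>
         (\<exists>v. (\<forall>i\<in>R. (\<Sum>c\<in>C. B i c * v c) = 0) \<and> (\<Sum>c\<in>C. a c * v c) = 1)"
  using assms(1)
proof (induction R arbitrary: a rule: finite_induct)
  case empty
  show ?case
  proof (cases "\<forall>c\<in>C. a c = 0")
    case False
    then obtain c0 where c0: "c0 \<in> C" "a c0 \<noteq> 0" by blast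
    have "(\<Sum>c\<in>C. a c * (if c = c0 then 1 / a c0 else 0)) = 1"
      using c0 \<open>finite C\<close> by (simp add: if_distrib sum.delta cong: if_cong)
    then show ?thesis by (intro disjI2 exI[of _ "\<lambda>c. if c = c0 then 1 / a c0 else 0"]) simp
  qed simp
next
  case (insert p R)
  have mem_span: "\<exists>z. \<forall>c\<in>C. f c = (\<Sum>i\<in>insert p R. z i * B i c)"
    if "\<forall>c\<in>C. f c - s * B p c = (\<Sum>i\<in>R. z i * B i c)" for f s z
  proof (intro exI[of _ "z(p := s)"] ballI)
    fix c assume "c \<in> C"
    have "(\<Sum>i\<in>R. (z(p := s)) i * B i c) = (\<Sum>i\<in>R. z i * B i c)"
      using insert.hyps by (intro sum.cong) auto
    then show "f c = (\<Sum>i\<in>insert p R. (z(p := s)) i * B i c)"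
      using that \<open>c \<in> C\<close> insert.hyps by (simp add: algebra_simps)
  qed
  show ?case
  proof (cases "\<exists>v. (\<forall>i\<in>R. (\<Sum>c\<in>C. B i c * v c) = 0) \<and> (\<Sum>c\<in>C. B p c * v c) = 1")
    case False
    then obtain y where y: "\<forall>c\<in>C. B p c = (\<Sum>i\<in>R. y i * B i c)"
      using insert.IH[of "B p"] by blast
    have perp: "(\<Sum>c\<in>C. B p c * v c) = 0" if "\<forall>i\<in>R. (\<Sum>c\<in>C. B i c * v c) = 0" for v
    proof -
      have "(\<Sum>c\<in>C. B p c * v c) = (\<Sum>c\<in>C. \<Sum>i\<in>R. y i * (B i c * v c))"
        using y by (intro sum.cong) (auto simp: sum_distrib_right mult.assoc)
      also have "\<dots> = (\<Sum>i\<in>R. y i * (\<Sum>c\<in>C. B i c * v c))"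
        by (subst sum.swap) (simp add: sum_distrib_left)
      finally show ?thesis using that by simp
    qed
    from insert.IH[of a] show ?thesis
    proof
      assume "\<exists>z. \<forall>c\<in>C. a c = (\<Sum>i\<in>R. z i * B i c)"
      then show ?thesis using mem_span[of a 0] by auto
    qed (use perp in auto)
  next
    case True
    then obtain v where v: "\<forall>i\<in>R. (\<Sum>c\<in>C. B i c * v c) = 0" "(\<Sum>c\<in>C. B p c * v c) = 1" by blast
    let ?s = "\<Sum>c\<in>C. a c * v c"
    from insert.IH[of "\<lambda>c. a c - ?s * B p c"] show ?thesis
    proof
      assume "\<exists>z. \<forall>c\<in>C. a c - ?s * B p c = (\<Sum>i\<in>R. z i * B i c)"
      then show ?thesis using mem_span[of a ?s] by blast
    next
      assume "\<exists>w. (\<forall>i\<in>R. (\<Sum>c\<in>C. B i c * w c) = 0) \<and> (\<Sum>c\<in>C. (a c - ?s * B p c) * w c) = 1"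
      then obtain w where w: "\<forall>i\<in>R. (\<Sum>c\<in>C. B i c * w c) = 0" "(\<Sum>c\<in>C. (a c - ?s * B p c) * w c) = 1"
        by blast
      let ?t = "\<Sum>c\<in>C. B p c * w c"
      have lin: "(\<Sum>c\<in>C. f c * (w c - t * v c)) = (\<Sum>c\<in>C. f c * w c) - t * (\<Sum>c\<in>C. f c * v c)" for f t
        by (simp add: right_diff_distrib sum_subtractf sum_distrib_left mult.left_commute)
      have "(\<Sum>c\<in>C. a c * w c) - ?s * ?t = 1"
        using w(2) by (simp add: left_diff_distrib sum_subtractf sum_distrib_left mult.assoc)
      then have "(\<Sum>c\<in>C. a c * (w c - ?t * v c)) = 1" unfolding lin by (simp add: mult.commute)
      moreover have "\<forall>i\<in>insert p R. (\<Sum>c\<in>C. B i c * (w c - ?t * v c)) = 0"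
        unfolding lin using v w(1) by simp
      ultimately show ?thesis by (intro disjI2 exI[of _ "\<lambda>c. w c - ?t * v c"] conjI)
    qed
  qed
qed

text \<open>
  Rank is expressed by a factorisation through an \<open>r\<close>-dimensional space. Row and column operations
  and the bordering of a matrix then become explicit changes of the two factors, and no
  determinants are needed until the conditions are compared with minors.
\<close>

definition rank_le :: "'r set \<Rightarrow> 'c set \<Rightarrow> ('r \<Rightarrow> 'c \<Rightarrow> 'f::field) \<Rightarrow> nat \<Rightarrow> bool" where
  "rank_le R C f r \<longleftrightarrow> (\<exists>u w. \<forall>i\<in>R. \<forall>c\<in>C. f i c = (\<Sum>s<r. u i s * w s c))"

lemma rank_leI:
  assumes "\<And>i c. i \<in> R \<Longrightarrow> c \<in> C \<Longrightarrow> f i c = (\<Sum>s<r. u i s * w s c)"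
  shows "rank_le R C f r"
  unfolding rank_le_def using assms by (intro exI[of _ u] exI[of _ w]) simp

lemma rank_le_transpose: "rank_le R C f r \<longleftrightarrow> rank_le C R (\<lambda>c i. f i c) r"
  (is "?L \<longleftrightarrow> ?R")
proof
  assume ?L
  then obtain u w where "\<forall>i\<in>R. \<forall>c\<in>C. f i c = (\<Sum>s<r. u i s * w s c)" unfolding rank_le_def by blast
  then show ?R unfolding rank_le_def
    by (intro exI[of _ "\<lambda>c s. w s c"] exI[of _ "\<lambda>s i. u i s"]) (simp add: mult.commute)
next
  assume ?R
  then obtain u w where "\<forall>c\<in>C. \<forall>i\<in>R. f i c = (\<Sum>s<r. u c s * w s i)" unfolding rank_le_def by blast
  then show ?L unfolding rank_le_def
    by (intro exI[of _ "\<lambda>i s. w s i"] exI[of _ "\<lambda>s c. u c s"]) (simp add: mult.commute)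
qed

lemma rank_le_cong:
  "(\<And>i c. i \<in> R \<Longrightarrow> c \<in> C \<Longrightarrow> f i c = g i c) \<Longrightarrow> rank_le R C f r \<longleftrightarrow> rank_le R C g r"
  unfolding rank_le_def by (intro ex_cong1) simp

lemma rank_le_index:
  assumes "finite S" and "\<And>i c. i \<in> R \<Longrightarrow> c \<in> C \<Longrightarrow> f i c = (\<Sum>s\<in>S. u i s * w s c)"
  shows "rank_le R C f (card S)"
proof -
  obtain g where "bij_betw g {0..<card S} S" using ex_bij_betw_nat_finite[OF assms(1)] by blast
  then have "(\<Sum>s<card S. u i (g s) * w (g s) c) = (\<Sum>s\<in>S. u i s * w s c)" for i c
    by (intro sum.reindex_bij_betw) (simp add: atLeast0LessThan)
  then show ?thesis unfolding rank_le_def using assms(2)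
    by (intro exI[of _ "\<lambda>i s. u i (g s)"] exI[of _ "\<lambda>s c. w (g s) c"]) simp
qed

lemma rank_le_insert_row:
  assumes "rank_le R C f r" and p: "\<And>c. c \<in> C \<Longrightarrow> f p c = (\<Sum>i\<in>R. z i * f i c)"
  shows "rank_le (insert p R) C f r"
proof -
  obtain u w where uw: "\<forall>i\<in>R. \<forall>c\<in>C. f i c = (\<Sum>s<r. u i s * w s c)"
    using assms(1) unfolding rank_le_def by blast
  have "f p c = (\<Sum>s<r. (\<Sum>i\<in>R. z i * u i s) * w s c)" if "c \<in> C" for c
  proof -
    have "f p c = (\<Sum>i\<in>R. \<Sum>s<r. z i * u i s * w s c)"
      unfolding p[OF that] using uw that by (intro sum.cong) (auto simp: sum_distrib_left mult.assoc)
    also have "\<dots> = (\<Sum>s<r. (\<Sum>i\<in>R. z i * u i s) * w s c)"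
      by (subst sum.swap) (simp add: sum_distrib_right)
    finally show ?thesis .
  qed
  then show ?thesis unfolding rank_le_def using uw
    by (intro exI[of _ "u(p := \<lambda>s. \<Sum>i\<in>R. z i * u i s)"] exI[of _ w]) auto
qed

lemma rank_le_insert_col:
  assumes "rank_le R C f r" and "\<And>i. i \<in> R \<Longrightarrow> f i p = (\<Sum>c\<in>C. z c * f i c)"
  shows "rank_le R (insert p C) f r"
  using rank_le_insert_row[of C R "\<lambda>c i. f i c" r p z] assms rank_le_transpose by metis

text \<open>
  A vector that separates row \<open>p\<close> from the other rows is mapped by \<open>w\<close> to a nonzero vector \<open>q\<close> of
  the \<open>r\<close>-dimensional space that is orthogonal to all \<open>u i\<close> with \<open>i \<in> R\<close>. So the rows in \<open>R\<close>
  factor through a hyperplane.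
\<close>

lemma rank_le_remove_row:
  assumes rk: "rank_le (insert p R) C f r" and fin: "finite R" "finite C"
    and indep: "\<nexists>z. \<forall>c\<in>C. f p c = (\<Sum>i\<in>R. z i * f i c)"
  shows "\<exists>r'. r = Suc r' \<and> rank_le R C f r'"
proof -
  obtain u w where uw: "\<forall>i\<in>insert p R. \<forall>c\<in>C. f i c = (\<Sum>s<r. u i s * w s c)"
    using rk unfolding rank_le_def by blast
  obtain v where v: "\<forall>i\<in>R. (\<Sum>c\<in>C. f i c * v c) = 0" "(\<Sum>c\<in>C. f p c * v c) = 1"
    using span_or_separated[OF fin, of "f p" f] indep by blast
  define q where "q s = (\<Sum>c\<in>C. w s c * v c)" for s
  have uq: "(\<Sum>c\<in>C. f i c * v c) = (\<Sum>s<r. u i s * q s)" if "i \<in> insert p R" for i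
  proof -
    have "(\<Sum>c\<in>C. f i c * v c) = (\<Sum>c\<in>C. \<Sum>s<r. u i s * (w s c * v c))"
      using uw that by (intro sum.cong) (auto simp: sum_distrib_right mult.assoc)
    also have "\<dots> = (\<Sum>s<r. u i s * q s)"
      unfolding q_def by (subst sum.swap) (simp add: sum_distrib_left)
    finally show ?thesis .
  qed
  have "\<exists>s<r. q s \<noteq> 0"
  proof (rule ccontr)
    assume "\<not> ?thesis"
    then have "(\<Sum>s<r. u p s * q s) = 0" by (intro sum.neutral) auto
    then show False using uq[of p] v(2) by simp
  qed
  then obtain t where t: "t < r" "q t \<noteq> 0" by blast
  \<comment> \<open>The \<open>t\<close>-th coordinate of \<open>u i\<close> is eliminated with the relation \<open>(\<Sum>s<r. u i s * q s) = 0\<close>.\<close>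
  have "f i c = (\<Sum>s\<in>{..<r}-{t}. u i s * (w s c - q s / q t * w t c))" if "i \<in> R" "c \<in> C" for i c
  proof -
    have "(\<Sum>s\<in>{..<r}-{t}. u i s * (w s c - q s / q t * w t c))
        = (\<Sum>s<r. u i s * (w s c - q s / q t * w t c))"
      using t by (intro sum.mono_neutral_left) auto
    also have "\<dots> = (\<Sum>s<r. u i s * w s c) - (\<Sum>s<r. u i s * q s) / q t * w t c"
      by (simp add: right_diff_distrib sum_subtractf sum_divide_distrib sum_distrib_right mult.assoc)
    also have "\<dots> = f i c" using uq[of i] v(1) uw that by simp
    finally show ?thesis ..
  qed
  then have "rank_le R C f (card ({..<r}-{t}))" by (intro rank_le_index) auto
  then show ?thesis using t by (intro exI[of _ "r - 1"]) auto
qed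

lemma rank_le_remove_col:
  assumes "rank_le R (insert p C) f r" "finite R" "finite C"
    and "\<nexists>z. \<forall>i\<in>R. f i p = (\<Sum>c\<in>C. z c * f i c)"
  shows "\<exists>r'. r = Suc r' \<and> rank_le R C f r'"
  using rank_le_remove_row[of p C R "\<lambda>c i. f i c" r] assms rank_le_transpose by metis

section \<open>Leading terms of polynomials that vanish under rank conditions\<close>

lemma isCont_zero_off_point:
  fixes g :: "complex \<Rightarrow> complex"
  assumes "isCont g 0" and "\<And>\<epsilon>. \<epsilon> \<noteq> 0 \<Longrightarrow> g \<epsilon> = 0"
  shows "g 0 = 0"
proof -
  have "(g \<longlongrightarrow> 0) (at 0)"
    using assms(2) by (intro tendsto_eventually) (auto simp: eventually_at_filter)
  then show ?thesis using assms(1) unfolding isCont_def using LIM_unique by blast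
qed

lemma less_Pair_Suc: "q < (c :: nat, Suc k) \<longleftrightarrow> q < (c, k) \<or> q = (c, k)"
  by (cases q) auto

text \<open>
  A matrix is given by its entries \<open>x (c, i)\<close> in column \<open>c\<close> and row \<open>i\<close>, so that the lexicographic
  order on positions is the order of the variables from the largest on. There are \<open>d\<close> rows, and
  only the columns in \<open>Act\<close> take part in the conditions: the block has the rows from \<open>j\<close> on and
  the columns in \<open>[a, e)\<close> that belong to \<open>Act\<close>.
\<close>

definition block_rank_le ::
    "nat \<Rightarrow> nat set \<Rightarrow> (nat \<times> nat \<Rightarrow> complex) \<Rightarrow> nat \<Rightarrow> nat \<Rightarrow> nat \<Rightarrow> nat \<Rightarrow> bool" where
  "block_rank_le d Act x j a e r \<longleftrightarrow> rank_le {j..<d} ({a..<e} \<inter> Act) (\<lambda>i c. x (c, i)) r"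

lemma block_rank_le_cong:
  assumes "\<And>c i. j \<le> i \<Longrightarrow> i < d \<Longrightarrow> a \<le> c \<Longrightarrow> c < e \<Longrightarrow> c \<in> Act \<Longrightarrow> x (c, i) = y (c, i)"
  shows "block_rank_le d Act x j a e r \<longleftrightarrow> block_rank_le d Act y j a e r"
  unfolding block_rank_le_def by (intro rank_le_cong) (auto intro!: assms)

lemma block_rank_le_empty: "d \<le> j \<or> e \<le> a \<Longrightarrow> block_rank_le d Act x j a e r"
  unfolding block_rank_le_def rank_le_def by auto

text \<open>
  The matrix \<open>(y, a; b, B + b a / y)\<close> with \<open>\<epsilon> = 1 / y\<close>, where \<open>a\<close> is row \<open>k\<close> to the right of
  column \<open>c\<close> and \<open>b\<close> is column \<open>c\<close> below row \<open>k\<close>. The corner itself is left to a later update of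
  \<open>(c, k)\<close>, so that the matrix depends continuously on \<open>\<epsilon>\<close> also at \<open>0\<close>.
\<close>

definition shear ::
    "nat \<Rightarrow> nat \<Rightarrow> (nat \<times> nat \<Rightarrow> complex) \<Rightarrow> complex \<Rightarrow> nat \<times> nat \<Rightarrow> complex" where
  "shear c k x \<epsilon> =
     (\<lambda>(c', i). if c < c' \<and> k < i then x (c', i) + \<epsilon> * x (c, i) * x (c', k)
                else x (c', i))"

text \<open>
  On a block that contains row \<open>k\<close> but not column \<open>c\<close>, the shear adds multiples of row \<open>k\<close> to
  lower rows.
\<close>

lemma shear_row_op:
  assumes "block_rank_le d Act x j a e r" "c < a" "j \<le> k" "k < d"
  shows "block_rank_le d Act ((shear c k x \<epsilon>)((c, k) := t)) j a e r"
proof -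
  obtain u w where uw: "\<forall>i\<in>{j..<d}. \<forall>c\<in>{a..<e} \<inter> Act. x (c, i) = (\<Sum>s<r. u i s * w s c)"
    using assms(1) unfolding block_rank_le_def rank_le_def by blast
  have "((shear c k x \<epsilon>)((c, k) := t)) (c', i)
      = (\<Sum>s<r. (if k < i then u i s + \<epsilon> * x (c, i) * u k s else u i s) * w s c')"
    if "i \<in> {j..<d}" "c' \<in> {a..<e} \<inter> Act" for i c'
  proof (cases "k < i")
    case True
    then show ?thesis
      using that uw assms(2-4)
      by (simp add: shear_def distrib_right sum.distrib sum_distrib_left mult.assoc)
  next
    case False
    then show ?thesis using that uw assms(2) by (simp add: shear_def)
  qed
  then show ?thesis unfolding block_rank_le_def
    by (rule rank_leI[where u = "\<lambda>i s. if k < i then u i s + \<epsilon> * x (c, i) * u k s else u i s" and w = "w"])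
qed

text \<open>
  On a block that contains column \<open>c\<close> but lies below row \<open>k\<close>, the shear adds multiples of column
  \<open>c\<close> to other columns.
\<close>

lemma shear_col_op:
  assumes "block_rank_le d Act x j c e r" "k < j" "c \<in> Act"
  shows "block_rank_le d Act ((shear c k x \<epsilon>)((c, k) := t)) j c e r"
proof -
  obtain u w where uw: "\<forall>i\<in>{j..<d}. \<forall>c'\<in>{c..<e} \<inter> Act. x (c', i) = (\<Sum>s<r. u i s * w s c')"
    using assms(1) unfolding block_rank_le_def rank_le_def by blast
  have "((shear c k x \<epsilon>)((c, k) := t)) (c', i)
      = (\<Sum>s<r. u i s * (if c < c' then w s c' + \<epsilon> * x (c', k) * w s c else w s c'))"
    if "i \<in> {j..<d}" "c' \<in> {c..<e} \<inter> Act" for i c'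
  proof (cases "c < c'")
    case True
    have "x (c, i) = (\<Sum>s<r. u i s * w s c)" using uw that assms(3) by auto
    then have "\<epsilon> * x (c, i) * x (c', k) = (\<Sum>s<r. u i s * (\<epsilon> * x (c', k) * w s c))"
      by (simp add: sum_distrib_left sum_distrib_right mult_ac)
    then show ?thesis
      using that uw assms(2) True by (simp add: shear_def distrib_left sum.distrib)
  next
    case False
    then show ?thesis using that uw assms(2) by (simp add: shear_def)
  qed
  then show ?thesis unfolding block_rank_le_def
    by (rule rank_leI[where u = "u" and w = "\<lambda>s c'. if c < c' then w s c' + \<epsilon> * x (c', k) * w s c else w s c'"])
qed

text \<open>
  With \<open>1 / \<epsilon>\<close> in the corner, the block is a matrix of rank one plus \<open>B\<close> bordered by zeros.
\<close>

lemma shear_corner: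
  assumes "block_rank_le d Act x (Suc k) (Suc c) e r" "\<epsilon> \<noteq> 0"
  shows "block_rank_le d Act ((shear c k x \<epsilon>)((c, k) := 1 / \<epsilon>)) k c e (Suc r)"
proof -
  obtain u w where uw:
    "\<forall>i\<in>{Suc k..<d}. \<forall>c'\<in>{Suc c..<e} \<inter> Act. x (c', i) = (\<Sum>s<r. u i s * w s c')"
    using assms(1) unfolding block_rank_le_def rank_le_def by blast
  \<comment> \<open>Coordinate \<open>r\<close> carries the rank one matrix \<open>(y, a; b, b a / y)\<close>, the others carry \<open>B\<close>.\<close>
  define u' where "u' i s = (if s < r then if i = k then 0 else u i s
                             else if i = k then 1 else \<epsilon> * x (c, i))" for i s
  define w' where "w' s c' = (if s < r then if c' = c then 0 else w s c'
                              else if c' = c then 1 / \<epsilon> else x (c', k))" for s c'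
  have "((shear c k x \<epsilon>)((c, k) := 1 / \<epsilon>)) (c', i) = (\<Sum>s<Suc r. u' i s * w' s c')"
    if "i \<in> {k..<d}" "c' \<in> {c..<e} \<inter> Act" for i c'
    using that uw assms(2)
    by (cases "i = k"; cases "c' = c") (auto simp: shear_def u'_def w'_def)
  then show ?thesis unfolding block_rank_le_def
    by (rule rank_leI[where u = "u'" and w = "w'"])
qed

text \<open>
  All blocks in \<open>E\<close> share the first row \<open>k\<close> and the first column \<open>c\<close> and differ only in their
  right end, so that one corner entry has to serve all of them. Suppose that in some block the row
  \<open>a\<close> is independent of \<open>B\<close> and so is the column \<open>b\<close>. The row stays independent in all wider
  blocks and the column in all narrower ones, so \<open>B\<close> has rank at most \<open>r - 1\<close> in every block.
  Otherwise every block has a dependent row or a dependent column. The column dependence in the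
  narrowest block that has one prescribes the corner entry, and this value fits all wider blocks;
  in the blocks whose column is independent, every corner entry is possible.
\<close>

lemma corner_completion:
  assumes "c \<in> Act" "k < d"
    and drop_col: "\<And>e r. (e, r) \<in> E \<Longrightarrow> block_rank_le d Act x k (Suc c) e r"
    and drop_row: "\<And>e r. (e, r) \<in> E \<Longrightarrow> block_rank_le d Act x (Suc k) c e r"
    and gt: "\<And>e r. (e, r) \<in> E \<Longrightarrow> c < e"
  shows "(\<exists>t. \<forall>(e, r)\<in>E. block_rank_le d Act (x((c, k) := t)) k c e r) \<or>
         (\<forall>(e, r)\<in>E. \<exists>r'. r = Suc r' \<and> block_rank_le d Act x (Suc k) (Suc c) e r')"
proof -
  define R where "R = {Suc k..<d}"
  define C where "C e = {Suc c..<e} \<inter> Act" for e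
  have rows: "{k..<d} = insert k R" and finR: "finite R" and kR: "k \<notin> R" using assms(2) by (auto simp: R_def)
  have cols: "{c..<e} \<inter> Act = insert c (C e)" if "c < e" for e
    using that assms(1) by (auto simp: C_def)
  have finC: "finite (C e)" and cC: "c \<notin> C e" for e by (auto simp: C_def)
  define rowdep where "rowdep e \<longleftrightarrow> (\<exists>z. \<forall>c'\<in>C e. x (c', k) = (\<Sum>i\<in>R. z i * x (c', i)))" for e
  define coldep where "coldep e \<longleftrightarrow> (\<exists>z. \<forall>i\<in>R. x (c, i) = (\<Sum>c'\<in>C e. z c' * x (c', i)))" for e
  have rowdep_mono: "rowdep e" if "rowdep e'" "e \<le> e'" for e e'
    using that unfolding rowdep_def C_def by (meson Int_iff atLeastLessThan_iff order_less_le_trans)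
  have extend: "(\<Sum>c'\<in>C e'. (if c' < e then z c' else 0) * f c') = (\<Sum>c'\<in>C e. z c' * f c')"
    if "e \<le> e'" for e e' z and f :: "nat \<Rightarrow> complex"
    using that by (intro sum.mono_neutral_cong_right) (auto simp: C_def)
  have coldep_mono: "coldep e'" if "coldep e" "e \<le> e'" for e e'
    using that(1) extend[OF that(2)] unfolding coldep_def by metis
  show ?thesis
  proof (cases "\<exists>(e, r)\<in>E. \<not> rowdep e \<and> \<not> coldep e")
    case True
    then obtain e1 r1 where e1: "\<not> rowdep e1" "\<not> coldep e1" by blast
    have "\<exists>r'. r = Suc r' \<and> block_rank_le d Act x (Suc k) (Suc c) e r'" if E: "(e, r) \<in> E" for e r
    proof (cases "e1 \<le> e")
      case True
      then have "\<not> rowdep e" using rowdep_mono e1 by blast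
      moreover have "rank_le (insert k R) (C e) (\<lambda>i c'. x (c', i)) r"
        using drop_col[OF E] unfolding block_rank_le_def rows C_def[symmetric] .
      ultimately show ?thesis
        unfolding block_rank_le_def rowdep_def R_def[symmetric] C_def[symmetric]
        by (intro rank_le_remove_row finR finC)
    next
      case False
      then have "\<not> coldep e" using coldep_mono[of e e1] e1 by auto
      moreover have "rank_le R (insert c (C e)) (\<lambda>i c'. x (c', i)) r"
        using drop_row[OF E] unfolding block_rank_le_def cols[OF gt[OF E]] R_def[symmetric] .
      ultimately show ?thesis
        unfolding block_rank_le_def coldep_def R_def[symmetric] C_def[symmetric]
        by (intro rank_le_remove_col finR finC)
    qed
    then show ?thesis by blast
  next
    case False
    define e0 where "e0 = (LEAST e. coldep e)"
    have "coldep e0" if "coldep e" for e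
      unfolding e0_def by (rule LeastI[of coldep, OF that])
    then obtain z where z: "\<And>e. coldep e \<Longrightarrow> \<forall>i\<in>R. x (c, i) = (\<Sum>c'\<in>C e0. z c' * x (c', i))"
      unfolding coldep_def[of e0] by (cases "\<exists>e. coldep e") blast+
    define t where "t = (\<Sum>c'\<in>C e0. z c' * x (c', k))"
    let ?x = "x((c, k) := t)"
    have "block_rank_le d Act ?x k c e r" if E: "(e, r) \<in> E" for e r
    proof (cases "coldep e")
      case True
      then have e0: "e0 \<le> e" unfolding e0_def by (rule Least_le)
      have "rank_le {k..<d} (insert c (C e)) (\<lambda>i c'. ?x (c', i)) r"
      proof (rule rank_le_insert_col[where f = "\<lambda>i c'. ?x (c', i)" and z = "\<lambda>c'. if c' < e0 then z c' else 0"])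
        show "rank_le {k..<d} (C e) (\<lambda>i c'. ?x (c', i)) r"
          using drop_col[OF E] cC unfolding block_rank_le_def C_def[symmetric]
          by (subst rank_le_cong[where f = "\<lambda>i c'. ?x (c', i)" and g = "\<lambda>i c'. x (c', i)"]) auto
        fix i assume "i \<in> {k..<d}"
        then have "?x (c, i) = (\<Sum>c'\<in>C e0. z c' * x (c', i))"
          using z[OF True] unfolding rows t_def by auto
        also have "\<dots> = (\<Sum>c'\<in>C e. (if c' < e0 then z c' else 0) * ?x (c', i))"
          unfolding extend[OF e0, symmetric] using cC by (intro sum.cong) auto
        finally show "?x (c, i) = \<dots>" .
      qed
      then show ?thesis unfolding block_rank_le_def cols[OF gt[OF E]] .
    next
      case notcol: False
      then obtain y where y: "\<forall>c'\<in>C e. x (c', k) = (\<Sum>i\<in>R. y i * x (c', i))"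
        using False E unfolding rowdep_def by blast
      obtain v where v: "\<forall>c'\<in>C e. (\<Sum>i\<in>R. x (c', i) * v i) = 0" "(\<Sum>i\<in>R. x (c, i) * v i) = 1"
        using span_or_separated[OF finC finR, of "\<lambda>i. x (c, i)" "\<lambda>c' i. x (c', i)" e] notcol
        unfolding coldep_def by meson
      \<comment> \<open>The row dependence \<open>y\<close> fits a corner entry that may differ from \<open>t\<close>. Multiples of \<open>v\<close> may
        be added to \<open>y\<close>, since \<open>v\<close> does not change the other entries of the row, and they correct
        the corner by \<open>h\<close>.\<close>
      define h where "h = t - (\<Sum>i\<in>R. y i * x (c, i))"
      have "rank_le (insert k R) ({c..<e} \<inter> Act) (\<lambda>i c'. ?x (c', i)) r"
      proof (rule rank_le_insert_row[where f = "\<lambda>i c'. ?x (c', i)" and z = "\<lambda>i. y i + h * v i"])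
        show "rank_le R ({c..<e} \<inter> Act) (\<lambda>i c'. ?x (c', i)) r"
          using drop_row[OF E] kR unfolding block_rank_le_def R_def[symmetric]
          by (subst rank_le_cong[where f = "\<lambda>i c'. ?x (c', i)" and g = "\<lambda>i c'. x (c', i)"]) auto
        fix c' assume c': "c' \<in> {c..<e} \<inter> Act"
        have "(\<Sum>i\<in>R. (y i + h * v i) * ?x (c', i)) = (\<Sum>i\<in>R. (y i + h * v i) * x (c', i))"
          using kR by (intro sum.cong) auto
        also have "\<dots> = (\<Sum>i\<in>R. y i * x (c', i)) + h * (\<Sum>i\<in>R. x (c', i) * v i)"
          by (simp add: algebra_simps sum.distrib sum_distrib_left)
        also have "\<dots> = ?x (c', k)"
          using c' cols[OF gt[OF E]] y v cC unfolding h_def by auto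
        finally show "?x (c', k) = (\<Sum>i\<in>R. (y i + h * v i) * ?x (c', i))" ..
      qed
      then show ?thesis unfolding block_rank_le_def rows .
    qed
    then show ?thesis by blast
  qed
qed

text \<open>
  The blocks that can occur when the variable in column \<open>c\<close> and row \<open>k\<close> is the largest one left,
  apart from empty blocks: those that start in column \<open>c\<close> lie in the remaining rows of that
  column; those that start in the next column start at row \<open>k\<close> or above, so that the shear acts on
  them by row operations; those further to the right have all rows.
\<close>

definition admissible :: "nat \<Rightarrow> nat \<Rightarrow> nat \<Rightarrow> nat \<Rightarrow> nat \<Rightarrow> nat \<Rightarrow> bool" where
  "admissible d c k j a e \<longleftrightarrow>
     d \<le> j \<or> e \<le> a \<or> a = c \<and> k \<le> j \<or> a = Suc c \<and> j \<le> k \<or> Suc c < a \<and> j = 0"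

lemma shear_noncorner:
  assumes "c \<in> Act" "k < d" "admissible d c k j a e" "\<not> (j = k \<and> a = c \<and> c < e)"
    and "block_rank_le d Act x j a e r"
  shows "block_rank_le d Act ((shear c k x \<epsilon>)((c, k) := t)) j a e r"
proof -
  consider "d \<le> j \<or> e \<le> a" | "a = c" "k < j" | "c < a" "j \<le> k"
    using assms(3,4) unfolding admissible_def by force
  then show ?thesis
    using block_rank_le_empty shear_row_op[OF assms(5)] shear_col_op[of d Act x j c e r k] assms
    by cases auto
qed

text \<open>
  The sequence has \<open>r + 1\<close> positions, so that a rank bound \<open>r\<close> is matched with the main diagonal
  of a minor that it forces to vanish.
\<close>

definition has_diagonal ::
    "nat \<Rightarrow> nat set \<Rightarrow> (nat \<times> nat) set \<Rightarrow> nat \<Rightarrow> nat \<Rightarrow> nat \<Rightarrow> nat \<Rightarrow> bool" where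
  "has_diagonal d Act P j a e r \<longleftrightarrow> (\<exists>rs cs.
     (\<forall>s\<le>r. rs s \<in> {j..<d} \<and> cs s \<in> {a..<e} \<inter> Act \<and> (cs s, rs s) \<in> P) \<and>
     (\<forall>s t. s < t \<and> t \<le> r \<longrightarrow> rs s < rs t \<and> cs s < cs t))"

lemma has_diagonal_mono:
  assumes "has_diagonal d Act P j a e r" "j' \<le> j" "{a..<e} \<inter> Act \<subseteq> {a'..<e'} \<inter> Act"
  shows "has_diagonal d Act P j' a' e' r"
proof -
  obtain rs cs where
    "\<forall>s\<le>r. rs s \<in> {j..<d} \<and> cs s \<in> {a..<e} \<inter> Act \<and> (cs s, rs s) \<in> P"
    and "\<forall>s t. s < t \<and> t \<le> r \<longrightarrow> rs s < rs t \<and> cs s < cs t"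
    using assms(1) unfolding has_diagonal_def by blast
  moreover have "{j..<d} \<subseteq> {j'..<d}" using assms(2) by auto
  ultimately show ?thesis
    using assms(3) unfolding has_diagonal_def by (intro exI[of _ rs] exI[of _ cs]) (simp add: subset_iff)
qed

lemma has_diagonal_Cons:
  assumes "has_diagonal d Act P (Suc k) (Suc c) e r" "(c, k) \<in> P" "c \<in> Act" "c < e" "k < d"
  shows "has_diagonal d Act P k c e (Suc r)"
proof -
  obtain rs cs where diagonal:
    "\<And>s. s \<le> r \<Longrightarrow> rs s \<in> {Suc k..<d} \<and> cs s \<in> {Suc c..<e} \<inter> Act \<and> (cs s, rs s) \<in> P"
    and incr: "\<And>s t. s < t \<Longrightarrow> t \<le> r \<Longrightarrow> rs s < rs t \<and> cs s < cs t"
    using assms(1) unfolding has_diagonal_def by blast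
  have "case_nat k rs s \<in> {k..<d} \<and> case_nat c cs s \<in> {c..<e} \<inter> Act
      \<and> (case_nat c cs s, case_nat k rs s) \<in> P" if "s \<le> Suc r" for s
    using that assms(2-5) diagonal[of "s - 1"] by (cases s) auto
  moreover have "case_nat k rs s < case_nat k rs t \<and> case_nat c cs s < case_nat c cs t"
    if "s < t" "t \<le> Suc r" for s t
    using that diagonal[of "t - 1"] incr[of "s - 1" "t - 1"] by (cases s; cases t) auto
  ultimately show ?thesis
    unfolding has_diagonal_def by (intro exI[of _ "case_nat k rs"] exI[of _ "case_nat c cs"]) simp
qed

text \<open>
  A polynomial in the entries of a \<open>d \<times> n\<close> matrix, given by its terms, their coefficients and
  their exponents. The last assumption says that \<open>m0\<close> is the lexicographically largest term:
  another term can exceed it at a position only if the two differ before.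
\<close>

locale lex_leading_term =
  fixes d n :: nat and Act :: "nat set"
    and T :: "'t set" and coef :: "'t \<Rightarrow> complex" and ex :: "'t \<Rightarrow> nat \<times> nat \<Rightarrow> nat" and m0 :: 't
  assumes fin: "finite T" and m0: "m0 \<in> T" and coef: "m \<in> T \<Longrightarrow> coef m \<noteq> 0"
    and inj: "inj_on ex T"
    and supp: "m \<in> T \<Longrightarrow> q \<notin> {..<n} \<times> {..<d} \<Longrightarrow> ex m q = 0"
    and lexmax: "m \<in> T \<Longrightarrow> (\<And>q'. q' < q \<Longrightarrow> ex m q' = ex m0 q') \<Longrightarrow> ex m q \<le> ex m0 q"
begin

text \<open>
  The part of the polynomial that still matters at position \<open>(c, k)\<close>: passing to the top
  coefficient with respect to each earlier variable keeps the terms that agree with \<open>m0\<close> there.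
  These variables are not divided out; instead \<open>vanishes\<close> evaluates them at \<open>1\<close>.
\<close>

definition tail :: "nat \<Rightarrow> nat \<Rightarrow> 't set" where
  "tail c k = {m \<in> T. \<forall>q<(c, k). ex m q = ex m0 q}"

definition val :: "(nat \<times> nat \<Rightarrow> complex) \<Rightarrow> 't \<Rightarrow> complex" where
  "val x m = (\<Prod>q\<in>{..<n} \<times> {..<d}. x q ^ ex m q)"

definition vanishes :: "nat \<Rightarrow> nat \<Rightarrow> (nat \<times> nat \<times> nat \<times> nat) set \<Rightarrow> bool" where
  "vanishes c k K \<longleftrightarrow> (\<forall>x. (\<forall>q<(c, k). x q = 1) \<longrightarrow>
     (\<forall>(j, a, e, r)\<in>K. block_rank_le d Act x j a e r) \<longrightarrow> (\<Sum>m\<in>tail c k. coef m * val x m) = 0)"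

lemma tail_Suc: "tail c (Suc k) = {m \<in> tail c k. ex m (c, k) = ex m0 (c, k)}"
  unfolding tail_def less_Pair_Suc by blast

lemma tail_next_column: "tail (Suc c) 0 = tail c d"
proof -
  have "ex m q = ex m0 q" if "m \<in> T" "q < (Suc c, 0)" "\<not> q < (c, d)" for m q
    using that supp[of m q] supp[of m0 q] m0 by (cases q) (auto simp: less_Suc_eq)
  moreover have "q < (Suc c, 0)" if "q < (c, d)" for q using that by (cases q) auto
  ultimately show ?thesis unfolding tail_def by blast
qed

text \<open>
  Divided by the highest power of the variable at \<open>(c, k)\<close>, the value of the polynomial along the
  curve \<open>X\<close> tends to the value of its top coefficient at \<open>X 0\<close>.
\<close>

lemma limit_at_infinity:
  assumes y: "c < n" "k < d"
    and cont: "\<And>q. isCont (\<lambda>\<epsilon>. X \<epsilon> q) 0"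
    and X0: "X 0 (c, k) = 1"
    and zero: "\<And>\<epsilon>. \<epsilon> \<noteq> 0 \<Longrightarrow> (\<Sum>m\<in>tail c k. coef m * val ((X \<epsilon>)((c, k) := 1 / \<epsilon>)) m) = 0"
  shows "(\<Sum>m\<in>tail c (Suc k). coef m * val (X 0) m) = 0"
proof -
  let ?y = "(c, k)" and ?D = "{..<n} \<times> {..<d} - {(c, k)}"
  define rest where "rest x m = (\<Prod>q\<in>?D. x q ^ ex m q)" for x :: "nat \<times> nat \<Rightarrow> complex" and m
  have val: "val (x(?y := t)) m = t ^ ex m ?y * rest x m" for x t m
    unfolding val_def rest_def using y by (subst prod.remove[of _ ?y]) auto
  have val0: "val (X 0) m = rest (X 0) m" for m
    using val[of "X 0" 1 m] X0 by (metis fun_upd_triv mult_1 power_one)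
  have le: "ex m ?y \<le> ex m0 ?y" if "m \<in> tail c k" for m
    using that lexmax[of m ?y] unfolding tail_def by blast
  define g where "g \<epsilon> = (\<Sum>m\<in>tail c k. coef m * (\<epsilon> ^ (ex m0 ?y - ex m ?y) * rest (X \<epsilon>) m))" for \<epsilon>
  have "g 0 = 0"
  proof (rule isCont_zero_off_point)
    show "isCont g 0" unfolding g_def rest_def by (intro continuous_intros cont)
    fix \<epsilon> :: complex assume "\<epsilon> \<noteq> 0"
    then have "\<epsilon> ^ (ex m0 ?y - ex m ?y) * rest (X \<epsilon>) m
        = \<epsilon> ^ ex m0 ?y * val ((X \<epsilon>)(?y := 1 / \<epsilon>)) m" if "m \<in> tail c k" for m
      using le[OF that] unfolding val by (simp add: power_diff power_one_over)
    then have "g \<epsilon> = \<epsilon> ^ ex m0 ?y * (\<Sum>m\<in>tail c k. coef m * val ((X \<epsilon>)(?y := 1 / \<epsilon>)) m)"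
      unfolding g_def by (simp add: sum_distrib_left mult.left_commute)
    then show "g \<epsilon> = 0" using zero[OF \<open>\<epsilon> \<noteq> 0\<close>] by simp
  qed
  moreover have "g 0 = (\<Sum>m\<in>tail c (Suc k). coef m * val (X 0) m)"
    unfolding g_def tail_Suc
  proof (rule sum.mono_neutral_cong_right)
    show "finite (tail c k)" unfolding tail_def using fin by simp
  next
    show "\<forall>m\<in>tail c k - {m \<in> tail c k. ex m ?y = ex m0 ?y}.
        coef m * (0 ^ (ex m0 ?y - ex m ?y) * rest (X 0) m) = 0"
      using le by (auto simp: le_less)
  qed (auto simp: val0)
  ultimately show ?thesis by simp
qed

text \<open>
  A condition set \<open>K'\<close> may replace \<open>K\<close> if each of its points either becomes a point of \<open>K\<close> after a
  change of one entry on which the polynomial does not depend, or is the end point of a curve in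
  \<open>K\<close> along which this entry goes to infinity.
\<close>

lemma vanishes_by_limit:
  assumes y: "c < n" "k < d"
    and van: "vanishes c k K"
    and reach: "\<And>x. (\<forall>q<(c, Suc k). x q = 1) \<Longrightarrow> (\<forall>(j, a, e, r)\<in>K'. block_rank_le d Act x j a e r) \<Longrightarrow>
      (\<exists>t. ex m0 (c, k) = 0 \<and> (\<forall>(j, a, e, r)\<in>K. block_rank_le d Act (x((c, k) := t)) j a e r)) \<or>
      (\<forall>\<epsilon>. \<epsilon> \<noteq> 0 \<longrightarrow>
         (\<forall>(j, a, e, r)\<in>K. block_rank_le d Act ((X x \<epsilon>)((c, k) := 1 / \<epsilon>)) j a e r))"
    and X: "\<And>x. X x 0 = x" "\<And>x q. isCont (\<lambda>\<epsilon>. X x \<epsilon> q) 0"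
      "\<And>x \<epsilon> q. q < (c, k) \<Longrightarrow> X x \<epsilon> q = x q"
  shows "vanishes c (Suc k) K'"
  unfolding vanishes_def
proof (intro allI impI)
  fix x assume one: "\<forall>q<(c, Suc k). x q = 1" and sat: "\<forall>(j, a, e, r)\<in>K'. block_rank_le d Act x j a e r"
  from reach[OF one sat] show "(\<Sum>m\<in>tail c (Suc k). coef m * val x m) = 0"
  proof
    assume "\<exists>t. ex m0 (c, k) = 0 \<and> (\<forall>(j, a, e, r)\<in>K. block_rank_le d Act (x((c, k) := t)) j a e r)"
    then obtain t where t: "ex m0 (c, k) = 0"
      "\<forall>(j, a, e, r)\<in>K. block_rank_le d Act (x((c, k) := t)) j a e r" by blast
    have "\<forall>q<(c, k). (x((c, k) := t)) q = 1"
      using one unfolding less_Pair_Suc by (metis fun_upd_other order_less_irrefl)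
    then have "(\<Sum>m\<in>tail c k. coef m * val (x((c, k) := t)) m) = 0"
      using van t(2) unfolding vanishes_def by blast
    moreover have zero: "ex m (c, k) = 0" if "m \<in> tail c k" for m
    proof -
      have "ex m (c, k) \<le> ex m0 (c, k)" using that lexmax[of m "(c, k)"] unfolding tail_def by blast
      then show ?thesis using t(1) by simp
    qed
    moreover have "val (x((c, k) := t)) m = val x m" if "m \<in> tail c k" for m
      unfolding val_def using zero[OF that] by (intro prod.cong) auto
    moreover have "tail c (Suc k) = tail c k"
      unfolding tail_Suc using zero t(1) by auto
    ultimately show ?thesis by simp
  next
    assume *: "\<forall>\<epsilon>. \<epsilon> \<noteq> 0 \<longrightarrow>
      (\<forall>(j, a, e, r)\<in>K. block_rank_le d Act ((X x \<epsilon>)((c, k) := 1 / \<epsilon>)) j a e r)"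
    have "(\<Sum>m\<in>tail c (Suc k). coef m * val (X x 0) m) = 0"
    proof (rule limit_at_infinity[OF y])
      show "X x 0 (c, k) = 1" using one X(1) by (simp add: less_Pair_Suc)
      fix \<epsilon> :: complex assume "\<epsilon> \<noteq> 0"
      moreover have "((X x \<epsilon>)((c, k) := 1 / \<epsilon>)) q = 1" if "q < (c, k)" for q
        using that X(3)[OF that, of x \<epsilon>] one unfolding less_Pair_Suc by (metis fun_upd_other order_less_irrefl)
      ultimately show "(\<Sum>m\<in>tail c k. coef m * val ((X x \<epsilon>)((c, k) := 1 / \<epsilon>)) m) = 0"
        using van[unfolded vanishes_def, rule_format, of "(X x \<epsilon>)((c, k) := 1 / \<epsilon>)"] * by blast
    qed (rule X(2))
    then show ?thesis by (simp add: X(1))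
  qed
qed

abbreviation diagonal :: "nat \<Rightarrow> nat \<Rightarrow> nat \<Rightarrow> nat \<Rightarrow> bool" where
  "diagonal \<equiv> has_diagonal d Act {q. ex m0 q \<noteq> 0}"

text \<open>
  The conditions \<open>E\<close> with the current variable in their corner are replaced as follows. If column
  \<open>c\<close> is not in \<open>Act\<close>, the block loses nothing by starting in the next column. If the variable
  does not occur in the leading term, its row and its column are dropped separately. If it occurs,
  both are dropped and the rank is lowered by one; a condition of rank \<open>0\<close> cannot be lowered, but
  then the variable alone is a diagonal.
\<close>

lemma diagonal_in_leading_term_step:
  assumes y: "c < n" "k < d"
    and allow: "\<And>j a e r. (j, a, e, r) \<in> K \<Longrightarrow> admissible d c k j a e"
    and van: "vanishes c k K"
    and IH: "\<And>K'. (\<And>j a e r. (j, a, e, r) \<in> K' \<Longrightarrow> admissible d c (Suc k) j a e) \<Longrightarrow>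
               vanishes c (Suc k) K' \<Longrightarrow> \<exists>(j, a, e, r)\<in>K'. diagonal j a e r"
  shows "\<exists>(j, a, e, r)\<in>K. diagonal j a e r"
proof -
  define corner where "corner j a e \<longleftrightarrow> j = k \<and> a = c \<and> c < e" for j a e
  define K0 where "K0 = {(j, a, e, r). (j, a, e, r) \<in> K \<and> \<not> corner j a e}"
  define E where "E = {(e, r). (k, c, e, r) \<in> K \<and> c < e}"
  have K0_admissible: "admissible d c (Suc k) j a e" if "(j, a, e, r) \<in> K0" for j a e r
    using that allow[of j a e r] unfolding K0_def admissible_def corner_def by auto
  have K0_noncorner: "admissible d c k j a e" "\<not> (j = k \<and> a = c \<and> c < e)" if "(j, a, e, r) \<in> K0" for j a e r
    using that allow[of j a e r] unfolding K0_def corner_def by auto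
  have K_cases: "(j, a, e, r) \<in> K0 \<or> j = k \<and> a = c \<and> (e, r) \<in> E" if "(j, a, e, r) \<in> K" for j a e r
    using that unfolding K0_def E_def corner_def by auto
  have cont: "isCont (\<lambda>\<epsilon>. shear c k x \<epsilon> q) 0" for x q
    unfolding shear_def by (cases q; cases "c < fst q \<and> k < snd q") (auto intro!: continuous_intros)
  have shear0: "shear c k x 0 = x" for x unfolding shear_def by auto
  have shear_before: "shear c k x \<epsilon> q = x q" if "q < (c, k)" for x \<epsilon> q
    using that unfolding shear_def by (cases q) auto
  consider (inactive) "c \<notin> Act" | (zero) "c \<in> Act" "ex m0 (c, k) = 0" | (pos) "c \<in> Act" "ex m0 (c, k) \<noteq> 0"
    by blast
  then show ?thesis
  proof cases
    case inactive
    define K' where "K' = K0 \<union> {(k, Suc c, e, r) | e r. (e, r) \<in> E}"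
    \<comment> \<open>The variable is in no block, so it may be sent to infinity without changing anything else.\<close>
    have same: "{Suc c..<e} \<inter> Act = {c..<e} \<inter> Act" for e
      using inactive by (auto simp: Suc_le_eq le_less)
    have sat: "block_rank_le d Act (x((c, k) := t)) j a e r \<longleftrightarrow> block_rank_le d Act x j a e r" for x t j a e r
      using inactive by (intro block_rank_le_cong) auto
    have "\<exists>(j, a, e, r)\<in>K'. diagonal j a e r"
    proof (rule IH)
      show "admissible d c (Suc k) j a e" if "(j, a, e, r) \<in> K'" for j a e r
        using that K0_admissible unfolding K'_def by (auto simp: admissible_def)
      show "vanishes c (Suc k) K'"
      proof (rule vanishes_by_limit[OF y van, where X = "\<lambda>x \<epsilon>. x"])
        fix x assume K': "\<forall>(j, a, e, r)\<in>K'. block_rank_le d Act x j a e r"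
        have "block_rank_le d Act x k c e r" if "(e, r) \<in> E" for e r
        proof -
          have "block_rank_le d Act x k (Suc c) e r" using K' that unfolding K'_def by blast
          then show ?thesis unfolding block_rank_le_def same .
        qed
        moreover have "block_rank_le d Act x j a e r" if "(j, a, e, r) \<in> K0" for j a e r
          using K' that unfolding K'_def by blast
        ultimately have "block_rank_le d Act x j a e r" if "(j, a, e, r) \<in> K" for j a e r
          using K_cases[OF that] by blast
        then show "(\<exists>t. ex m0 (c, k) = 0 \<and> (\<forall>(j, a, e, r)\<in>K. block_rank_le d Act (x((c, k) := t)) j a e r)) \<or>
          (\<forall>\<epsilon>. \<epsilon> \<noteq> 0 \<longrightarrow> (\<forall>(j, a, e, r)\<in>K. block_rank_le d Act (x((c, k) := 1 / \<epsilon>)) j a e r))"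
          unfolding sat by blast
      qed auto
    qed
    then obtain j a e r where "(j, a, e, r) \<in> K'" and ch: "diagonal j a e r" by blast
    then consider "(j, a, e, r) \<in> K0" | "j = k" "a = Suc c" "(e, r) \<in> E" unfolding K'_def by blast
    then show ?thesis
    proof cases
      case 2
      then have "diagonal k c e r" using same by (intro has_diagonal_mono[OF ch]) auto
      then show ?thesis using 2 unfolding E_def by blast
    qed (use ch in \<open>auto simp: K0_def\<close>)
  next
    case zero
    define K' where "K' = K0 \<union> {(k, Suc c, e, r) | e r. (e, r) \<in> E} \<union> {(Suc k, c, e, r) | e r. (e, r) \<in> E}"
    have "\<exists>(j, a, e, r)\<in>K'. diagonal j a e r"
    proof (rule IH)
      show "admissible d c (Suc k) j a e" if "(j, a, e, r) \<in> K'" for j a e r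
        using that K0_admissible unfolding K'_def by (auto simp: admissible_def)
      show "vanishes c (Suc k) K'"
      proof (rule vanishes_by_limit[OF y van, where X = "shear c k"])
        fix x assume sat: "\<forall>(j, a, e, r)\<in>K'. block_rank_le d Act x j a e r"
        have drop_col: "block_rank_le d Act x k (Suc c) e r" and drop_row: "block_rank_le d Act x (Suc k) c e r"
          if "(e, r) \<in> E" for e r
          using sat that unfolding K'_def by blast+
        have "c < e" if "(e, r) \<in> E" for e r using that unfolding E_def by blast
        have K0: "block_rank_le d Act x j a e r" if "(j, a, e, r) \<in> K0" for j a e r
          using sat that unfolding K'_def by blast
        from corner_completion[OF zero(1) y(2), of E x] drop_col drop_row \<open>\<And>e r. (e, r) \<in> E \<Longrightarrow> c < e\<close>
        have "(\<exists>t. \<forall>(e, r)\<in>E. block_rank_le d Act (x((c, k) := t)) k c e r) \<or>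
          (\<forall>(e, r)\<in>E. \<exists>r'. r = Suc r' \<and> block_rank_le d Act x (Suc k) (Suc c) e r')" by blast
        then show "(\<exists>t. ex m0 (c, k) = 0 \<and> (\<forall>(j, a, e, r)\<in>K. block_rank_le d Act (x((c, k) := t)) j a e r)) \<or>
          (\<forall>\<epsilon>. \<epsilon> \<noteq> 0 \<longrightarrow>
             (\<forall>(j, a, e, r)\<in>K. block_rank_le d Act ((shear c k x \<epsilon>)((c, k) := 1 / \<epsilon>)) j a e r))"
        proof
          assume "\<exists>t. \<forall>(e, r)\<in>E. block_rank_le d Act (x((c, k) := t)) k c e r"
          then obtain t where t: "\<And>e r. (e, r) \<in> E \<Longrightarrow> block_rank_le d Act (x((c, k) := t)) k c e r" by blast
          have "block_rank_le d Act (x((c, k) := t)) j a e r" if "(j, a, e, r) \<in> K" for j a e r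
          proof (cases "(j, a, e, r) \<in> K0")
            case True
            have "block_rank_le d Act (x((c, k) := t)) j a e r \<longleftrightarrow> block_rank_le d Act x j a e r"
              if "\<not> (d \<le> j \<or> e \<le> a)"
              using that K0_admissible[OF True] by (intro block_rank_le_cong) (auto simp: admissible_def)
            then show ?thesis using K0[OF True] block_rank_le_empty by blast
          qed (use t K_cases[OF that] in auto)
          then show ?thesis using zero(2) by blast
        next
          assume drop: "\<forall>(e, r)\<in>E. \<exists>r'. r = Suc r' \<and> block_rank_le d Act x (Suc k) (Suc c) e r'"
          have "block_rank_le d Act ((shear c k x \<epsilon>)((c, k) := 1 / \<epsilon>)) k c e r"
            if "(e, r) \<in> E" "\<epsilon> \<noteq> 0" for e r \<epsilon>
          proof -
            from drop that(1) obtain r' where "r = Suc r'" "block_rank_le d Act x (Suc k) (Suc c) e r'" by blast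
            then show ?thesis using shear_corner[OF _ that(2)] by simp
          qed
          moreover have "block_rank_le d Act ((shear c k x \<epsilon>)((c, k) := 1 / \<epsilon>)) j a e r"
            if "(j, a, e, r) \<in> K0" for j a e r \<epsilon>
            using shear_noncorner[OF zero(1) y(2) K0_noncorner[OF that] K0[OF that]] .
          ultimately show ?thesis using K_cases by blast
        qed
      qed (use cont shear0 shear_before in auto)
    qed
    then obtain j a e r where "(j, a, e, r) \<in> K'" and ch: "diagonal j a e r" by blast
    then consider "(j, a, e, r) \<in> K0" | "j = k" "a = Suc c" "(e, r) \<in> E" | "j = Suc k" "a = c" "(e, r) \<in> E"
      unfolding K'_def by blast
    then show ?thesis
    proof cases
      case 1
      then show ?thesis using ch by (auto simp: K0_def)
    next
      case 2
      then have "diagonal k c e r" by (intro has_diagonal_mono[OF ch]) auto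
      then show ?thesis using 2 unfolding E_def by blast
    next
      case 3
      then have "diagonal k c e r" by (intro has_diagonal_mono[OF ch]) auto
      then show ?thesis using 3 unfolding E_def by blast
    qed
  next
    case pos
    show ?thesis
    proof (cases "\<exists>e. (e, 0) \<in> E")
      case True
      then obtain e where e: "(k, c, e, 0) \<in> K" "c < e" unfolding E_def by blast
      have "diagonal k c e 0"
        unfolding has_diagonal_def using e(2) y pos
        by (intro exI[of _ "\<lambda>_. k"] exI[of _ "\<lambda>_. c"]) simp
      then show ?thesis using e(1) by blast
    next
      case False
      define K' where "K' = K0 \<union> {(Suc k, Suc c, e, r) | e r. (e, Suc r) \<in> E}"
      have "\<exists>(j, a, e, r)\<in>K'. diagonal j a e r"
      proof (rule IH)
        show "admissible d c (Suc k) j a e" if "(j, a, e, r) \<in> K'" for j a e r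
          using that K0_admissible unfolding K'_def by (auto simp: admissible_def)
        show "vanishes c (Suc k) K'"
        proof (rule vanishes_by_limit[OF y van, where X = "shear c k"])
          fix x assume sat: "\<forall>(j, a, e, r)\<in>K'. block_rank_le d Act x j a e r"
          have "block_rank_le d Act ((shear c k x \<epsilon>)((c, k) := 1 / \<epsilon>)) k c e r"
            if "(e, r) \<in> E" "\<epsilon> \<noteq> 0" for e r \<epsilon>
          proof -
            from that False obtain r' where r: "r = Suc r'" by (cases r) auto
            have "block_rank_le d Act x (Suc k) (Suc c) e r'" using sat that r unfolding K'_def by blast
            then show ?thesis unfolding r using that by (intro shear_corner)
          qed
          moreover have "block_rank_le d Act ((shear c k x \<epsilon>)((c, k) := 1 / \<epsilon>)) j a e r"
            if "(j, a, e, r) \<in> K0" for j a e r \<epsilon>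
            using shear_noncorner[OF pos(1) y(2) K0_noncorner[OF that]] sat that unfolding K'_def by blast
          ultimately show "(\<exists>t. ex m0 (c, k) = 0 \<and> (\<forall>(j, a, e, r)\<in>K. block_rank_le d Act (x((c, k) := t)) j a e r)) \<or>
          (\<forall>\<epsilon>. \<epsilon> \<noteq> 0 \<longrightarrow>
             (\<forall>(j, a, e, r)\<in>K. block_rank_le d Act ((shear c k x \<epsilon>)((c, k) := 1 / \<epsilon>)) j a e r))"
            using K_cases by blast
        qed (use cont shear0 shear_before in auto)
      qed
      then obtain j a e r where "(j, a, e, r) \<in> K'" and ch: "diagonal j a e r" by blast
      then consider "(j, a, e, r) \<in> K0" | "j = Suc k" "a = Suc c" "(e, Suc r) \<in> E"
        unfolding K'_def by blast
      then show ?thesis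
      proof cases
        case 1
        then show ?thesis using ch by (auto simp: K0_def)
      next
        case 2
        then have "diagonal k c e (Suc r)" using ch pos y by (intro has_diagonal_Cons) (auto simp: E_def)
        then show ?thesis using 2 unfolding E_def by blast
      qed
    qed
  qed
qed

text \<open>
  After the last row of a column, the blocks that start there have become empty and the next
  column begins. After the last column, only the leading term is left. It does not vanish at the
  matrix with entries \<open>1\<close> before position \<open>(c, k)\<close> and \<open>0\<close> elsewhere, and this matrix satisfies
  all conditions, because its admissible blocks are zero or empty.
\<close>

lemma diagonal_in_leading_term:
  assumes "\<And>j a e r. (j, a, e, r) \<in> K \<Longrightarrow> admissible d c k j a e" "vanishes c k K" "c \<le> n" "k \<le> d"
  shows "\<exists>(j, a, e, r)\<in>K. diagonal j a e r"
  using assms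
proof (induction "(n - c, d - k)" arbitrary: c k K rule: less_induct)
  case less
  show ?case
  proof (cases "c = n")
    case True
    have one: "ex m q = ex m0 q" if "m \<in> tail c k" for m q
      using that m0 supp[of m q] supp[of m0 q] True unfolding tail_def
      by (cases q; cases "q \<in> {..<n} \<times> {..<d}") auto
    have "m = m0" if "m \<in> tail c k" for m
    proof -
      have "ex m = ex m0" using one[OF that] by (rule ext)
      then show ?thesis using inj_onD[OF inj] m0 that by (simp add: tail_def)
    qed
    moreover have "m0 \<in> tail c k" using m0 by (simp add: tail_def)
    ultimately have "tail c k = {m0}" by blast
    define x where "x = (\<lambda>q. if q < (c, k) then 1 else 0 :: complex)"
    have "val x m0 = 1"
      unfolding val_def x_def using True by (intro prod.neutral) auto
    have sat: "block_rank_le d Act x j a e r" if "(j, a, e, r) \<in> K" for j a e r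
    proof (cases "d \<le> j \<or> e \<le> a")
      case False
      then show ?thesis
        unfolding block_rank_le_def x_def using less.prems(1)[OF that]
        by (intro rank_leI[where u = "\<lambda>_ _. 0" and w = "\<lambda>_ _. 0"]) (auto simp: admissible_def)
    qed (rule block_rank_le_empty)
    have "\<forall>q<(c, k). x q = 1" by (simp add: x_def)
    moreover have "\<forall>(j, a, e, r)\<in>K. block_rank_le d Act x j a e r" using sat by blast
    ultimately have "(\<Sum>m\<in>tail c k. coef m * val x m) = 0"
      using less.prems(2) unfolding vanishes_def by blast
    then show ?thesis using \<open>tail c k = {m0}\<close> \<open>val x m0 = 1\<close> coef[OF m0] by simp
  next
    case cn: False
    show ?thesis
    proof (cases "k = d")
      case True
      have before: "q < (Suc c, 0)" if "q < (c, d)" for q using that by (cases q) auto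
      show ?thesis
      proof (rule less.hyps)
        have "n - Suc c < n - c" using cn less.prems(3) by arith
        then show "(n - Suc c, d - 0) < (n - c, d - k)" by simp
        show "vanishes (Suc c) 0 K"
          using less.prems(2) before unfolding vanishes_def True tail_next_column by blast
        show "admissible d (Suc c) 0 j a e" if "(j, a, e, r) \<in> K" for j a e r
          using less.prems(1)[OF that] True unfolding admissible_def by auto
      qed (use cn less.prems in auto)
    next
      case False
      show ?thesis
      proof (rule diagonal_in_leading_term_step)
        fix K' assume "\<And>j a e r. (j, a, e, r) \<in> K' \<Longrightarrow> admissible d c (Suc k) j a e" "vanishes c (Suc k) K'"
        then show "\<exists>(j, a, e, r)\<in>K'. diagonal j a e r"
          using False cn less.prems by (intro less.hyps[of c "Suc k"]) auto
      qed (use False cn less.prems in auto)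
    qed
  qed
qed

end

section \<open>Polynomial values and leading monomials of minors\<close>

definition monomial_value :: "('v \<Rightarrow> complex) \<Rightarrow> ('v \<Rightarrow>\<^sub>0 nat) \<Rightarrow> complex" where
  "monomial_value x m = (\<Prod>v\<in>Poly_Mapping.keys m. x v ^ Poly_Mapping.lookup m v)"

definition poly_value :: "('v \<Rightarrow> complex) \<Rightarrow> 'v mpoly \<Rightarrow> complex" where
  "poly_value x p = (\<Sum>m\<in>Poly_Mapping.keys p. Poly_Mapping.lookup p m * monomial_value x m)"

lemma monomial_value_superset:
  assumes "finite V" "Poly_Mapping.keys m \<subseteq> V"
  shows "monomial_value x m = (\<Prod>v\<in>V. x v ^ Poly_Mapping.lookup m v)"
  unfolding monomial_value_def using assms
  by (intro prod.mono_neutral_left) (auto simp: in_keys_iff)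

lemma monomial_value_add: "monomial_value x (a + b) = monomial_value x a * monomial_value x b"
  using monomial_value_superset[of "Poly_Mapping.keys a \<union> Poly_Mapping.keys b" _ x]
    Poly_Mapping.keys_add[of a b]
  by (simp add: lookup_add power_add prod.distrib)

lemma monomial_value_zero: "monomial_value x 0 = 1"
  by (simp add: monomial_value_def)

lemma monomial_value_single: "monomial_value x (Poly_Mapping.single v 1) = x v"
  by (simp add: monomial_value_def)

lemma monomial_value_sum: "monomial_value x (\<Sum>i\<in>A. f i) = (\<Prod>i\<in>A. monomial_value x (f i))"
  by (induction A rule: infinite_finite_induct) (simp_all add: monomial_value_zero monomial_value_add)

lemma poly_value_superset:
  assumes "finite M" "Poly_Mapping.keys p \<subseteq> M"
  shows "poly_value x p = (\<Sum>m\<in>M. Poly_Mapping.lookup p m * monomial_value x m)"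
  unfolding poly_value_def using assms
  by (intro sum.mono_neutral_left) (auto simp: in_keys_iff)

lemma poly_value_add: "poly_value x (p + q) = poly_value x p + poly_value x q"
  using poly_value_superset[of "Poly_Mapping.keys p \<union> Poly_Mapping.keys q" _ x]
    Poly_Mapping.keys_add[of p q]
  by (simp add: lookup_add distrib_right sum.distrib)

lemma poly_value_zero: "poly_value x 0 = 0"
  by (simp add: poly_value_def)

lemma poly_value_sum: "poly_value x (\<Sum>i\<in>A. f i) = (\<Sum>i\<in>A. poly_value x (f i))"
  by (induction A rule: infinite_finite_induct) (simp_all add: poly_value_zero poly_value_add)

lemma poly_value_single: "poly_value x (Poly_Mapping.single m c) = c * monomial_value x m"
  by (simp add: poly_value_def)

lemma sum_of_terms:
  fixes p :: "'a \<Rightarrow>\<^sub>0 'b::comm_monoid_add"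
  shows "p = (\<Sum>m\<in>Poly_Mapping.keys p. Poly_Mapping.single m (Poly_Mapping.lookup p m))"
  by (rule poly_mapping_eqI) (simp add: lookup_sum lookup_single when_def in_keys_iff)

lemma poly_value_mult: "poly_value x (p * q) = poly_value x p * poly_value x q"
proof -
  have "p * q = (\<Sum>a\<in>Poly_Mapping.keys p. \<Sum>b\<in>Poly_Mapping.keys q.
      Poly_Mapping.single (a + b) (Poly_Mapping.lookup p a * Poly_Mapping.lookup q b))"
    by (subst sum_of_terms[of p], subst sum_of_terms[of q]) (simp add: sum_product mult_single)
  then have "poly_value x (p * q) = (\<Sum>a\<in>Poly_Mapping.keys p. \<Sum>b\<in>Poly_Mapping.keys q.
      (Poly_Mapping.lookup p a * monomial_value x a) * (Poly_Mapping.lookup q b * monomial_value x b))"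
    by (simp add: poly_value_sum poly_value_single monomial_value_add mult_ac)
  then show ?thesis by (simp add: poly_value_def sum_product)
qed

lemma poly_ring_sel:
  "carrier (poly_ring V) = {p. \<forall>m \<in> Poly_Mapping.keys p. Poly_Mapping.keys m \<subseteq> V}"
  "(\<otimes>\<^bsub>poly_ring V\<^esub>) = (*)" "(\<oplus>\<^bsub>poly_ring V\<^esub>) = (+)" "\<one>\<^bsub>poly_ring V\<^esub> = 1" "\<zero>\<^bsub>poly_ring V\<^esub> = 0"
  by (simp_all add: poly_ring_def)

text \<open>
  The polynomials that vanish on \<open>X\<close> form an ideal.
\<close>

lemma genideal_vanishes:
  assumes F: "F \<subseteq> carrier (poly_ring V)" and van: "\<And>f x. f \<in> F \<Longrightarrow> x \<in> X \<Longrightarrow> poly_value x f = 0"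
    and "p \<in> Idl\<^bsub>poly_ring V\<^esub> F" "x \<in> X"
  shows "poly_value x p = 0"
proof -
  let ?R = "poly_ring V"
  interpret cring ?R by (rule cring_poly_ring)
  let ?I = "{p \<in> carrier ?R. \<forall>x\<in>X. poly_value x p = 0}"
  have minus: "\<ominus>\<^bsub>?R\<^esub> p = - p" if "p \<in> carrier ?R" for p
    using that by (intro minus_equality) (auto simp: poly_ring_sel)
  have "poly_value x (- p) = - poly_value x p" for x and p :: "'a mpoly"
    by (simp add: poly_value_def sum_negf)
  then have "poly_value x (\<ominus>\<^bsub>?R\<^esub> p) = 0" if "p \<in> carrier ?R" "poly_value x p = 0" for x p
    using that minus by simp
  moreover have "poly_value x (p \<oplus>\<^bsub>?R\<^esub> q) = poly_value x p + poly_value x q"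
    "poly_value x \<zero>\<^bsub>?R\<^esub> = 0" for x and p q :: "'a mpoly"
    by (simp_all add: poly_ring_sel poly_value_add poly_value_zero)
  ultimately have "additive_subgroup ?I ?R"
    by (intro additive_subgroup.intro add.subgroupI) auto
  moreover have "poly_value x (p \<otimes>\<^bsub>?R\<^esub> q) = poly_value x p * poly_value x q" for x p q
    by (simp add: poly_ring_sel poly_value_mult)
  ultimately have "ideal ?I ?R"
    by (intro ideal.intro ideal_axioms.intro ring_axioms) auto
  then have "Idl\<^bsub>?R\<^esub> F \<subseteq> ?I" using F van by (intro genideal_minimal) auto
  then show ?thesis using assms(3,4) by blast
qed

lemma det_eq_0_if_rank_le:
  fixes f :: "'r \<Rightarrow> 'c \<Rightarrow> 'f::field"
  assumes "rank_le R C f r" "\<And>a. a < Suc r \<Longrightarrow> rs a \<in> R" "\<And>b. b < Suc r \<Longrightarrow> cs b \<in> C"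
  shows "det (mat (Suc r) (Suc r) (\<lambda>(a, b). f (rs a) (cs b))) = 0"
proof -
  obtain u w where uw: "\<forall>i\<in>R. \<forall>c\<in>C. f i c = (\<Sum>s<r. u i s * w s c)"
    using assms(1) unfolding rank_le_def by blast
  let ?n = "Suc r"
  define U where "U = mat ?n ?n (\<lambda>(a, s). if s < r then u (rs a) s else 0)"
  define W where "W = mat ?n ?n (\<lambda>(s, b). if s < r then w s (cs b) else 0)"
  have U: "U \<in> carrier_mat ?n ?n" and W: "W \<in> carrier_mat ?n ?n" unfolding U_def W_def by auto
  have "mat ?n ?n (\<lambda>(a, b). f (rs a) (cs b)) = U * W"
  proof (rule eq_matI)
    fix a b assume ab: "a < dim_row (U * W)" "b < dim_col (U * W)"
    then have ab': "a < ?n" "b < ?n" using U W by auto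
    have "(U * W) $$ (a, b) = (\<Sum>s<?n. (if s < r then u (rs a) s else 0) * (if s < r then w s (cs b) else 0))"
      using ab' unfolding U_def W_def by (simp add: scalar_prod_def atLeast0LessThan)
    also have "\<dots> = (\<Sum>s<r. u (rs a) s * w s (cs b))" by simp
    finally show "mat ?n ?n (\<lambda>(a, b). f (rs a) (cs b)) $$ (a, b) = (U * W) $$ (a, b)"
      using ab' uw assms(2,3) by simp
  qed (auto simp: U_def W_def)
  moreover have "det W = 0"
  proof -
    have "(\<Prod>i = 0..<?n. W $$ (i, p i)) = 0" if "p permutes {0..<?n}" for p
    proof (rule prod_zero)
      have "p r < ?n" using permutes_in_image[OF that, of r] by simp
      then show "\<exists>i\<in>{0..<?n}. W $$ (i, p i) = 0" unfolding W_def by (intro bexI[of _ r]) auto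
    qed simp
    then show ?thesis unfolding det_def'[OF W] by (intro sum.neutral) simp
  qed
  ultimately show ?thesis using det_mult[OF U W] by simp
qed

text \<open>
  The indeterminate in column \<open>c\<close> and row \<open>i\<close> of the generic matrix, both counted from \<open>0\<close>. By
  \<open>var_at_less\<close> the numbering of the positions respects the order of the indeterminates.
\<close>

definition var_at :: "nat \<times> nat \<Rightarrow> idx" where
  "var_at = (\<lambda>(c, i). (c div 2 + 1, c mod 2 + 1, i + 1))"

lemma var_at_less: "var_at q < var_at q' \<longleftrightarrow> q < q'"
proof -
  have split: "2 * a + b < 2 * a' + b' \<longleftrightarrow> a < a' \<or> a = a' \<and> b < b'"
    "2 * a + b = 2 * a' + b' \<longleftrightarrow> a = a' \<and> b = b'"
    if "b < 2" "b' < 2" for a b a' b' :: nat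
    using that by arith+
  have "c < c' \<longleftrightarrow> c div 2 < c' div 2 \<or> c div 2 = c' div 2 \<and> c mod 2 < c' mod 2"
    "c = c' \<longleftrightarrow> c div 2 = c' div 2 \<and> c mod 2 = c' mod 2" for c c' :: nat
    using split[of "c mod 2" "c' mod 2" "c div 2" "c' div 2"] by simp_all
  moreover obtain c i c' i' where q: "q = (c, i)" "q' = (c', i')" by (cases q; cases q') auto
  have "var_at q < var_at q' \<longleftrightarrow> c div 2 < c' div 2 \<or>
      c div 2 = c' div 2 \<and> (c mod 2 < c' mod 2 \<or> c mod 2 = c' mod 2 \<and> i < i')"
    unfolding q var_at_def prod.case less_idx_iff by simp
  moreover have "q < q' \<longleftrightarrow> c < c' \<or> c = c' \<and> i < i'"
    unfolding q by auto
  ultimately show ?thesis by blast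
qed

lemma var_at_inj: "var_at q = var_at q' \<longleftrightarrow> q = q'"
  using var_at_less[of q q'] var_at_less[of q' q] by (metis less_irrefl linorder_neqE)

lemma indets_image: "indets d k2 = var_at ` ({..<2 * k2} \<times> {..<d})"
proof (intro equalityI subsetI)
  fix v assume "v \<in> indets d k2"
  then obtain l j i where v: "v = (l, j, i)" "1 \<le> l" "l \<le> k2" "j = 1 \<or> j = 2" "1 \<le> i" "i \<le> d"
    unfolding indets_def by force
  then have "var_at (2 * (l - 1) + (j - 1), i - 1) = v" "2 * (l - 1) + (j - 1) < 2 * k2" "i - 1 < d"
    by (auto simp: var_at_def)
  then show "v \<in> var_at ` ({..<2 * k2} \<times> {..<d})" by (intro image_eqI[of v var_at "(2 * (l - 1) + (j - 1), i - 1)"]) auto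
qed (auto simp: var_at_def indets_def)

definition minor_at :: "nat \<Rightarrow> (nat \<Rightarrow> nat) \<Rightarrow> (nat \<Rightarrow> nat) \<Rightarrow> idx mpoly" where
  "minor_at r rs cs =
     det (mat r r (\<lambda>(a, b). Poly_Mapping.single (Poly_Mapping.single (var_at (cs b, rs a)) 1) 1))"

definition perm_monomial :: "nat \<Rightarrow> (nat \<Rightarrow> nat) \<Rightarrow> (nat \<Rightarrow> nat) \<Rightarrow> (nat \<Rightarrow> nat) \<Rightarrow> (idx \<Rightarrow>\<^sub>0 nat)" where
  "perm_monomial r rs cs p = (\<Sum>a = 0..<r. Poly_Mapping.single (var_at (cs (p a), rs a)) 1)"

lemma prod_single_one:
  "(\<Prod>a\<in>A. Poly_Mapping.single (f a) 1) = (Poly_Mapping.single (\<Sum>a\<in>A. f a) 1 :: 'v mpoly)"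
  by (induction A rule: infinite_finite_induct) (simp_all add: mult_single)

lemma signof_single:
  "signof p * Poly_Mapping.single m 1 = (Poly_Mapping.single m (signof p) :: 'v mpoly)"
  by (simp add: sign_def single_uminus)

lemma minor_at_expand:
  "minor_at r rs cs = (\<Sum>p | p permutes {0..<r}. Poly_Mapping.single (perm_monomial r rs cs p) (signof p))"
proof -
  have "(\<Prod>a = 0..<r. mat r r (\<lambda>(a, b). Poly_Mapping.single (Poly_Mapping.single (var_at (cs b, rs a)) 1) 1) $$ (a, p a))
      = (Poly_Mapping.single (perm_monomial r rs cs p) 1 :: idx mpoly)" if "p permutes {0..<r}" for p
    unfolding perm_monomial_def prod_single_one[symmetric]
    using permutes_in_image[OF that] by (intro prod.cong) auto
  then show ?thesis unfolding minor_at_def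
    by (subst det_def'[of _ r]) (auto simp: signof_single intro!: sum.cong)
qed

lemma poly_value_minor_at:
  "poly_value x (minor_at r rs cs) = det (mat r r (\<lambda>(a, b). x (var_at (cs b, rs a))))"
proof -
  have "(\<Prod>a = 0..<r. mat r r (\<lambda>(a, b). x (var_at (cs b, rs a))) $$ (a, p a))
      = monomial_value x (perm_monomial r rs cs p)" if "p permutes {0..<r}" for p
    unfolding perm_monomial_def monomial_value_sum monomial_value_single
    using permutes_in_image[OF that] by (intro prod.cong) auto
  then show ?thesis unfolding minor_at_expand poly_value_sum poly_value_single
    by (subst det_def'[of _ r]) (auto intro!: sum.cong)
qed

lemma keys_perm_monomial:
  "Poly_Mapping.keys (perm_monomial r rs cs p) \<subseteq> {var_at (cs (p a), rs a) | a. a < r}"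
  unfolding perm_monomial_def by (rule order.trans[OF keys_sum]) auto

lemma keys_minor_at:
  "Poly_Mapping.keys (minor_at r rs cs) \<subseteq> perm_monomial r rs cs ` {p. p permutes {0..<r}}"
  unfolding minor_at_expand by (rule order.trans[OF keys_sum]) auto

lemma lookup_perm_monomial:
  assumes "strict_mono_on {..<r} rs"
  shows "Poly_Mapping.lookup (perm_monomial r rs cs p) (var_at (c, i))
       = (if \<exists>a<r. cs (p a) = c \<and> rs a = i then 1 else 0)"
proof -
  have "Poly_Mapping.lookup (perm_monomial r rs cs p) (var_at (c, i))
      = (\<Sum>a = 0..<r. if cs (p a) = c \<and> rs a = i then 1 else 0)"
    unfolding perm_monomial_def
    by (auto simp: lookup_sum lookup_single when_def var_at_inj intro!: sum.cong)
  also have "\<dots> = (if \<exists>a<r. cs (p a) = c \<and> rs a = i then 1 else 0)"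
  proof (cases "\<exists>a<r. cs (p a) = c \<and> rs a = i")
    case True
    then obtain a where a: "a < r" "cs (p a) = c" "rs a = i" by blast
    have "rs b = rs a \<Longrightarrow> b = a" if "b < r" for b
      using strict_mono_on_imp_inj_on[OF assms] that a(1) by (auto dest: inj_onD)
    then have "cs (p b) = c \<and> rs b = i \<longleftrightarrow> b = a" if "b < r" for b
      using that a(2,3) by metis
    then have "(\<Sum>b = 0..<r. if cs (p b) = c \<and> rs b = i then 1 else 0)
        = (\<Sum>b = 0..<r. if b = a then 1 else 0 :: nat)"
      by (intro sum.cong) simp_all
    then show ?thesis using True a by simp
  qed (auto intro!: sum.neutral)
  finally show ?thesis .
qed

text \<open>
  Let \<open>b\<close> be the least index that \<open>p\<close> moves. The two terms agree in the columns before \<open>b\<close>. In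
  column \<open>b\<close> the identity term has the variable of row \<open>b\<close>. As \<open>p\<close> fixes the earlier rows and
  moves row \<open>b\<close>, its own variable in column \<open>b\<close> is in a later row, hence smaller.
\<close>

lemma perm_monomial_less_diagonal:
  assumes rs: "strict_mono_on {..<r} rs" and cs: "strict_mono_on {..<r} cs"
    and p: "p permutes {0..<r}" "p \<noteq> id"
  shows "perm_monomial r rs cs p < perm_monomial r rs cs id"
proof -
  have "\<exists>b. p b \<noteq> b" using p(2) by (auto simp: fun_eq_iff)
  define b where "b = (LEAST b. p b \<noteq> b)"
  have pb: "p b \<noteq> b" unfolding b_def by (rule LeastI_ex) fact
  have fixed: "p b' = b'" if "b' < b" for b' using not_less_Least that unfolding b_def by blast
  have br: "b < r" using permutes_not_in[OF p(1), of b] pb by auto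
  have rs_inj: "rs a = rs a' \<longleftrightarrow> a = a'" if "a < r" "a' < r" for a a'
    using that strict_mono_on_imp_inj_on[OF rs] unfolding inj_on_def by auto
  have cs_inj: "cs a = cs a' \<longleftrightarrow> a = a'" if "a < r" "a' < r" for a a'
    using that strict_mono_on_imp_inj_on[OF cs] unfolding inj_on_def by auto
  have p_inj: "p a = p a' \<longleftrightarrow> a = a'" for a a' using permutes_inj[OF p(1)] by (auto simp: inj_def)
  have pr: "p a < r" if "a < r" for a using that permutes_in_image[OF p(1), of a] by simp
  note look = lookup_perm_monomial[OF rs]
  let ?v = "var_at (cs b, rs b)"
  have "Poly_Mapping.lookup (perm_monomial r rs cs p) ?v = 0"
  proof -
    have "\<not> (cs (p a) = cs b \<and> rs a = rs b)" if "a < r" for a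
      using rs_inj[OF that br] cs_inj[OF pr[OF br] br] pb by auto
    then show ?thesis unfolding look by auto
  qed
  moreover have "Poly_Mapping.lookup (perm_monomial r rs cs id) ?v = 1"
    unfolding look using br by auto
  moreover have "Poly_Mapping.lookup (perm_monomial r rs cs p) v
      = Poly_Mapping.lookup (perm_monomial r rs cs id) v" if "v < ?v" for v
  proof -
    have same: "cs (p a) = c \<and> rs a = i \<longleftrightarrow> cs a = c \<and> rs a = i"
      if q: "(c, i) < (cs b, rs b)" and a: "a < r" for c i a
    proof (cases "a < b")
      case True
      then show ?thesis using fixed by simp
    next
      case False
      have "\<not> p a < b" using False fixed[of "p a"] p_inj[of a "p a"] by auto
      have "rs b \<le> rs a" using False strict_mono_on_less_eq[OF rs, of b a] a br by simp
      moreover have "cs b \<le> cs (p a)" "cs b \<le> cs a"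
        using False \<open>\<not> p a < b\<close> strict_mono_on_less_eq[OF cs] a br pr[OF a] by simp_all
      ultimately show ?thesis using q by auto
    qed
    show ?thesis
    proof (cases "v \<in> range var_at")
      case True
      then obtain c i where v: "v = var_at (c, i)" by auto
      then show ?thesis using that same unfolding v look var_at_less by (metis id_apply)
    next
      case False
      then have "v \<notin> Poly_Mapping.keys (perm_monomial r rs cs q)" for q
        using keys_perm_monomial by blast
      then show ?thesis by (simp add: in_keys_iff)
    qed
  qed
  ultimately show ?thesis unfolding less_monomial_iff by (intro exI[of _ ?v]) simp
qed

lemma minor_at_leading:
  assumes "strict_mono_on {..<r} rs" "strict_mono_on {..<r} cs"
  shows "minor_at r rs cs \<noteq> 0"
    and "initial_monomial (minor_at r rs cs) = Poly_Mapping.single (perm_monomial r rs cs id) 1"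
proof -
  let ?m = "perm_monomial r rs cs id"
  have fin: "finite {p. p permutes {0..<r}}" by (simp add: finite_permutations)
  have less: "perm_monomial r rs cs p < ?m" if "p permutes {0..<r}" "p \<noteq> id" for p
    using perm_monomial_less_diagonal[OF assms that] .
  have "Poly_Mapping.lookup (Poly_Mapping.single (perm_monomial r rs cs p) (signof p)) ?m
      = (if p = id then 1 else 0 :: complex)" if "p permutes {0..<r}" for p
  proof (cases "p = id")
    case False
    then show ?thesis using less[OF that] by (auto simp: lookup_single when_def)
  qed simp
  then have "Poly_Mapping.lookup (minor_at r rs cs) ?m
      = (\<Sum>p | p permutes {0..<r}. if p = id then 1 else 0)"
    unfolding minor_at_expand lookup_sum by (intro sum.cong) auto
  also have "\<dots> = 1" using fin by (simp add: permutes_id)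
  finally have look: "?m \<in> Poly_Mapping.keys (minor_at r rs cs)" by (simp add: in_keys_iff)
  then show "minor_at r rs cs \<noteq> 0" by auto
  have "m \<le> ?m" if m: "m \<in> Poly_Mapping.keys (minor_at r rs cs)" for m
  proof -
    obtain p where p: "p permutes {0..<r}" "m = perm_monomial r rs cs p"
      using m keys_minor_at by blast
    then show ?thesis using less[OF p(1)] by (cases "p = id") auto
  qed
  then have "Max (Poly_Mapping.keys (minor_at r rs cs)) = ?m"
    using look by (intro Max_eqI) auto
  then show "initial_monomial (minor_at r rs cs) = Poly_Mapping.single ?m 1"
    unfolding initial_monomial_def by simp
qed

lemma minor_at_carrier:
  assumes "\<And>a b. a < r \<Longrightarrow> b < r \<Longrightarrow> var_at (cs b, rs a) \<in> V"
  shows "minor_at r rs cs \<in> carrier (poly_ring V)"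
proof -
  have "Poly_Mapping.keys (perm_monomial r rs cs p) \<subseteq> V" if "p permutes {0..<r}" for p
  proof -
    have "p a < r" if "a < r" for a using that permutes_in_image[OF \<open>p permutes {0..<r}\<close>, of a] by simp
    then show ?thesis using keys_perm_monomial[of r rs cs p] assms by blast
  qed
  then show ?thesis unfolding poly_ring_sel using keys_minor_at by blast
qed

definition minors_on :: "nat \<Rightarrow> nat set \<Rightarrow> nat \<Rightarrow> idx mpoly set" where
  "minors_on d C r = {minor_at r rs cs | rs cs. strict_mono_on {..<r} rs \<and> strict_mono_on {..<r} cs \<and>
     rs ` {..<r} \<subseteq> {..<d} \<and> cs ` {..<r} \<subseteq> C}"

lemma pick_image_strict_mono:
  assumes "strict_mono_on {..<r} f" "a < r"
  shows "pick (f ` {..<r}) a = f a"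
proof -
  have "{x \<in> f ` {..<r}. x < f a} = f ` {..<a}"
    using assms strict_mono_on_less[OF assms(1)] by (auto simp: image_iff) 
  moreover have "card (f ` {..<a}) = a"
    using assms strict_mono_on_imp_inj_on[OF assms(1)] 
    by (subst card_image) (auto intro: inj_on_subset)
  ultimately show ?thesis using pick_card_in_set[of "f a" "f ` {..<r}"] assms(2) by simp
qed

text \<open>
  A minor of a submatrix picks the chosen columns in two stages; the composition of two increasing
  selections is again increasing, and every increasing selection of columns in \<open>C\<close> arises in this
  way.
\<close>

lemma minors_cols_submatrix:
  assumes C: "col_pos ` U = C" "C \<subseteq> {..<2 * k2}"
  shows "minors r (cols_submatrix d k2 U) = minors_on d C r"
proof -
  let ?Y = "cols_submatrix d k2 U"
  have finC: "finite C" using C(2) finite_subset by blast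
  have setC: "{j. j < 2 * k2 \<and> j \<in> C} = C" using C(2) by auto
  have dimY: "dim_row ?Y = d" "dim_col ?Y = card C"
    unfolding cols_submatrix_def C(1) by (simp_all add: dim_submatrix generic_matrix_def setC)
  have entry: "?Y $$ (i, j) = Poly_Mapping.single (Poly_Mapping.single (var_at (pick C j, i)) 1) 1"
    if "i < d" "j < card C" for i j
  proof -
    have "?Y $$ (i, j) = generic_matrix d k2 $$ (i, pick C j)"
      unfolding cols_submatrix_def C(1)
      using that by (subst submatrix_index) (auto simp: generic_matrix_def setC pick_UNIV)
    moreover have "pick C j < 2 * k2" using pick_in_set_le[OF that(2)] C(2) by auto
    ultimately show ?thesis using that(1) by (simp add: generic_matrix_def indet_def var_at_def)
  qed
  have sub: "det (submatrix ?Y I J) = minor_at r (pick I) (\<lambda>b. pick C (pick J b))"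
    if "I \<subseteq> {..<d}" "J \<subseteq> {..<card C}" "card I = r" "card J = r" for I J
  proof -
    have set: "{i. i < d \<and> i \<in> I} = I" "{j. j < card C \<and> j \<in> J} = J" using that by auto
    have "pick I a < d" "pick J a < card C" if "a < r" for a
      using that pick_in_set_le[of a I] pick_in_set_le[of a J] \<open>I \<subseteq> {..<d}\<close> \<open>J \<subseteq> {..<card C}\<close>
        \<open>card I = r\<close> \<open>card J = r\<close> by auto
    then have "submatrix ?Y I J = mat r r (\<lambda>(a, b).
        Poly_Mapping.single (Poly_Mapping.single (var_at (pick C (pick J b), pick I a)) 1) 1)"
      using that unfolding submatrix_def dimY set by (intro eq_matI) (auto simp: entry)
    then show ?thesis unfolding minor_at_def by simp
  qed
  show ?thesis
  proof (intro equalityI subsetI)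
    fix f assume "f \<in> minors r ?Y"
    then obtain I J where IJ: "I \<subseteq> {..<d}" "J \<subseteq> {..<card C}" "card I = r" "card J = r"
      and f: "f = det (submatrix ?Y I J)"
      unfolding minors_def dimY by blast
    have J_less: "pick J b < card C" if "b < r" for b
      using that pick_in_set_le[of b J] IJ by auto
    have "strict_mono_on {..<r} (pick I)"
      using IJ(3) by (intro strict_mono_onI pick_mono_le) auto
    moreover have "strict_mono_on {..<r} (\<lambda>b. pick C (pick J b))"
      using IJ(4) J_less by (intro strict_mono_onI pick_mono_le) auto
    moreover have "pick I ` {..<r} \<subseteq> {..<d}"
      using pick_in_set_le[of _ I] IJ by auto
    moreover have "(\<lambda>b. pick C (pick J b)) ` {..<r} \<subseteq> C"
      using pick_in_set_le[of _ C] J_less by auto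
    ultimately show "f \<in> minors_on d C r" unfolding minors_on_def f sub[OF IJ] by blast
  next
    fix f assume "f \<in> minors_on d C r"
    then obtain rs cs where mono: "strict_mono_on {..<r} rs" "strict_mono_on {..<r} cs"
      and in_range: "rs ` {..<r} \<subseteq> {..<d}" "cs ` {..<r} \<subseteq> C" and f: "f = minor_at r rs cs"
      unfolding minors_on_def by blast
    define h where "h b = card {x \<in> C. x < cs b}" for b
    have pick_h: "pick C (h b) = cs b" if "b < r" for b
      unfolding h_def using in_range(2) that by (intro pick_card_in_set) auto
    have h_mono: "strict_mono_on {..<r} h"
    proof (rule strict_mono_onI)
      fix a b assume ab: "a \<in> {..<r}" "b \<in> {..<r}" "a < b"
      then have "cs a < cs b" using strict_mono_onD[OF mono(2)] by blast
      moreover have "cs a \<in> C" using in_range(2) ab by auto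
      ultimately have "{x \<in> C. x < cs a} \<subset> {x \<in> C. x < cs b}" by (intro psubsetI) auto
      then show "h a < h b" unfolding h_def using finC by (intro psubset_card_mono) auto
    qed
    have h_less: "h b < card C" if "b < r" for b
    proof -
      have "{x \<in> C. x < cs b} \<subset> C" using in_range(2) that by auto
      then show ?thesis unfolding h_def using finC by (intro psubset_card_mono)
    qed
    let ?I = "rs ` {..<r}" and ?J = "h ` {..<r}"
    have IJ: "?I \<subseteq> {..<d}" "?J \<subseteq> {..<card C}" "card ?I = r" "card ?J = r"
      using in_range h_less strict_mono_on_imp_inj_on[OF mono(1)] strict_mono_on_imp_inj_on[OF h_mono]
      by (auto simp: card_image)
    have "minor_at r (pick ?I) (\<lambda>b. pick C (pick ?J b)) = f"
    proof -
      have "pick ?I a = rs a" "pick C (pick ?J a) = cs a" if "a < r" for a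
        using pick_image_strict_mono[OF mono(1) that] pick_image_strict_mono[OF h_mono that]
          pick_h[OF that] by simp_all
      then show ?thesis
        unfolding f minor_at_def by (intro arg_cong[where f = det] eq_matI) simp_all
    qed
    then have "f = det (submatrix ?Y ?I ?J)" using sub[OF IJ] by simp
    then show "f \<in> minors r ?Y" unfolding minors_def dimY using IJ by blast
  qed
qed

lemma finite_minors: "finite (minors r Y)"
proof -
  have "minors r Y \<subseteq> (\<lambda>(I, J). det (submatrix Y I J)) ` (Pow {..<dim_row Y} \<times> Pow {..<dim_col Y})"
    unfolding minors_def by auto
  then show ?thesis by (rule finite_subset) simp
qed

section \<open>Minors of column intervals\<close>

text \<open>
  At the first position every interval of columns, with all rows, is an admissible block, so that
  the induction applies to an arbitrary set of such conditions.
\<close>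

lemma leading_monomial_above_minor:
  assumes p: "p \<in> carrier (poly_ring (indets d k2))" "p \<noteq> 0"
    and van: "\<And>x. (\<And>a e r. (a, e, r) \<in> K \<Longrightarrow> block_rank_le d Act (\<lambda>q. x (var_at q)) 0 a e r) \<Longrightarrow>
                 poly_value x p = 0"
  obtains a e r rs cs l where "(a, e, r) \<in> K"
    "strict_mono_on {..<Suc r} rs" "strict_mono_on {..<Suc r} cs"
    "rs ` {..<Suc r} \<subseteq> {..<d}" "cs ` {..<Suc r} \<subseteq> {a..<e} \<inter> Act"
    "Max (Poly_Mapping.keys p) = l + perm_monomial (Suc r) rs cs id"
proof -
  let ?m0 = "Max (Poly_Mapping.keys p)" and ?D = "{..<2 * k2} \<times> {..<d}"
  define ex where "ex m q = Poly_Mapping.lookup m (var_at q)" for m :: "idx \<Rightarrow>\<^sub>0 nat" and q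
  have m0: "?m0 \<in> Poly_Mapping.keys p" using p(2) by (intro Max_in) auto
  have outside: "Poly_Mapping.lookup m v = 0" if "m \<in> Poly_Mapping.keys p" "v \<notin> var_at ` ?D" for m v
  proof -
    have "Poly_Mapping.keys m \<subseteq> var_at ` ?D"
      using that(1) p(1) unfolding poly_ring_sel indets_image by blast
    then show ?thesis using that(2) by (auto simp flip: not_in_keys_iff_lookup_eq_zero)
  qed
  have inj_var: "inj var_at" by (rule injI) (simp add: var_at_inj)
  have D: "var_at q \<in> var_at ` ?D \<longleftrightarrow> q \<in> ?D" for q by (rule inj_image_mem_iff[OF inj_var])
  interpret lex_leading_term d "2 * k2" Act "Poly_Mapping.keys p" "Poly_Mapping.lookup p" ex ?m0
  proof
    show "inj_on ex (Poly_Mapping.keys p)"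
    proof (rule inj_onI, rule poly_mapping_eqI)
      fix m m' v assume m: "m \<in> Poly_Mapping.keys p" "m' \<in> Poly_Mapping.keys p" "ex m = ex m'"
      show "Poly_Mapping.lookup m v = Poly_Mapping.lookup m' v"
      proof (cases "v \<in> var_at ` ?D")
        case True
        then obtain q where "v = var_at q" by blast
        then show ?thesis using fun_cong[OF m(3), of q] by (simp add: ex_def)
      qed (use m outside in simp)
    qed
  next
    fix m q assume "m \<in> Poly_Mapping.keys p" "q \<notin> ?D"
    then show "ex m q = 0" unfolding ex_def using outside D by blast
  next
    fix m q assume m: "m \<in> Poly_Mapping.keys p" and eq: "\<And>q'. q' < q \<Longrightarrow> ex m q' = ex ?m0 q'"
    show "ex m q \<le> ex ?m0 q"
    proof (rule ccontr)
      assume "\<not> ?thesis"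
      then have "Poly_Mapping.lookup ?m0 (var_at q) < Poly_Mapping.lookup m (var_at q)"
        unfolding ex_def by simp
      moreover have "Poly_Mapping.lookup ?m0 v = Poly_Mapping.lookup m v" if "v < var_at q" for v
      proof (cases "v \<in> var_at ` ?D")
        case True
        then obtain q' where v: "v = var_at q'" by blast
        then show ?thesis using eq[of q'] that by (simp add: ex_def var_at_less)
      qed (use m m0 outside in simp)
      ultimately have "?m0 < m" unfolding less_monomial_iff by blast
      moreover have "m \<le> ?m0" using m by (intro Max_ge) auto
      ultimately show False by simp
    qed
  qed (use m0 in \<open>auto simp: in_keys_iff\<close>)
  have "vanishes 0 0 {(0, a, e, r) | a e r. (a, e, r) \<in> K}"
    unfolding vanishes_def
  proof (intro allI impI)
    fix y assume sat: "\<forall>(j, a, e, r)\<in>{(0, a, e, r) | a e r. (a, e, r) \<in> K}. block_rank_le d Act y j a e r"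
    define x where "x v = y (inv_into UNIV var_at v)" for v
    have x: "x (var_at q) = y q" for q unfolding x_def using inj_var by simp
    have "monomial_value x m = val y m" if "m \<in> Poly_Mapping.keys p" for m
    proof -
      have "monomial_value x m = (\<Prod>v\<in>var_at ` ?D. x v ^ Poly_Mapping.lookup m v)"
        using that p(1) unfolding poly_ring_sel indets_image
        by (intro monomial_value_superset) auto
      also have "\<dots> = val y m"
        unfolding val_def ex_def using inj_var by (subst prod.reindex) (auto simp: x intro: inj_on_subset)
      finally show ?thesis .
    qed
    then have "(\<Sum>m\<in>Poly_Mapping.keys p. Poly_Mapping.lookup p m * val y m) = poly_value x p"
      unfolding poly_value_def by simp
    also have "\<dots> = 0" using sat by (intro van) (auto simp: x)
    finally show "(\<Sum>m\<in>tail 0 0. Poly_Mapping.lookup p m * val y m) = 0"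
      by (simp add: tail_def)
  qed
  then have "\<exists>(j, a, e, r)\<in>{(0, a, e, r) | a e r. (a, e, r) \<in> K}. diagonal j a e r"
    by (intro diagonal_in_leading_term) (auto simp: admissible_def)
  then obtain a e r where K: "(a, e, r) \<in> K" and "diagonal 0 a e r" by blast
  then obtain rs cs where
    diagonal: "\<And>s. s \<le> r \<Longrightarrow> rs s \<in> {0..<d} \<and> cs s \<in> {a..<e} \<inter> Act \<and> ex ?m0 (cs s, rs s) \<noteq> 0"
    and incr: "\<And>s t. s < t \<Longrightarrow> t \<le> r \<Longrightarrow> rs s < rs t \<and> cs s < cs t"
    unfolding has_diagonal_def by blast
  have mono: "strict_mono_on {..<Suc r} rs" "strict_mono_on {..<Suc r} cs"
    using incr by (auto intro!: strict_mono_onI)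
  let ?d = "perm_monomial (Suc r) rs cs id"
  have "Poly_Mapping.lookup ?d v \<le> Poly_Mapping.lookup ?m0 v" for v
  proof (cases "v \<in> Poly_Mapping.keys ?d")
    case True
    then obtain s where s: "s < Suc r" "v = var_at (cs s, rs s)"
      using keys_perm_monomial[of "Suc r" rs cs id] by auto
    then have "Poly_Mapping.lookup ?d v \<le> 1" unfolding s(2) lookup_perm_monomial[OF mono(1)] by simp
    moreover have "Poly_Mapping.lookup ?m0 v \<noteq> 0" using diagonal[of s] s by (simp add: ex_def)
    ultimately show ?thesis by linarith
  qed (simp add: in_keys_iff)
  then have "?m0 = (?m0 - ?d) + ?d"
    by (intro poly_mapping_eqI) (simp add: lookup_add lookup_minus)
  moreover have "rs ` {..<Suc r} \<subseteq> {..<d}" "cs ` {..<Suc r} \<subseteq> {a..<e} \<inter> Act"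
    using diagonal by (auto simp: less_Suc_eq_le)
  ultimately show thesis using that K mono by blast
qed

text \<open>
  Minors of size \<open>r + 1\<close> vanish where the rank is at most \<open>r\<close>, so the leading monomial of every
  nonzero element of the ideal is a multiple of the main diagonal of a generator.
\<close>

theorem interval_minors_groebner:
  assumes Act: "Act \<subseteq> {..<2 * k2}"
    and F: "F = (\<Union>(a, e, r)\<in>K. minors_on d ({a..<e} \<inter> Act) (Suc r))" and fin: "finite F"
  shows "is_groebner_basis (indets d k2) F (Idl\<^bsub>poly_ring (indets d k2)\<^esub> F)"
proof -
  let ?R = "poly_ring (indets d k2)"
  interpret cring ?R by (rule cring_poly_ring)
  have F_carrier: "F \<subseteq> carrier ?R"
  proof
    fix f assume "f \<in> F"
    then obtain a e r rs cs where f: "f = minor_at (Suc r) rs cs"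
      "rs ` {..<Suc r} \<subseteq> {..<d}" "cs ` {..<Suc r} \<subseteq> {a..<e} \<inter> Act"
      unfolding F minors_on_def by blast
    show "f \<in> carrier ?R"
      unfolding f(1) indets_image
    proof (intro minor_at_carrier imageI)
      fix b c assume "b < Suc r" "c < Suc r"
      then have "rs b \<in> {..<d}" "cs c \<in> {..<2 * k2}" using f(2,3) Act by blast+
      then show "(cs c, rs b) \<in> {..<2 * k2} \<times> {..<d}" by simp
    qed
  qed
  have init: "initial_monomial p \<in> carrier ?R" if "p \<in> carrier ?R" "p \<noteq> 0" for p
  proof -
    have "Max (Poly_Mapping.keys p) \<in> Poly_Mapping.keys p" using that(2) by (intro Max_in) auto
    then show ?thesis using that(1) unfolding initial_monomial_def poly_ring_sel by auto
  qed
  let ?G = "initial_monomial ` (F - {0})" and ?I = "Idl\<^bsub>?R\<^esub> F"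
  have I_carrier: "?I \<subseteq> carrier ?R"
    using genideal_ideal[OF F_carrier] by (meson additive_subgroup.a_subset ideal.axioms(1))
  have F_I: "F \<subseteq> ?I" by (rule genideal_self[OF F_carrier])
  have G: "?G \<subseteq> carrier ?R" using init F_carrier by blast
  have L: "initial_monomial ` (?I - {0}) \<subseteq> carrier ?R" using init I_carrier by blast
  have "initial_monomial p \<in> Idl\<^bsub>?R\<^esub> ?G" if p: "p \<in> ?I" "p \<noteq> 0" for p
  proof -
    have p_carrier: "p \<in> carrier ?R" using p(1) I_carrier by blast
    have "poly_value x p = 0"
      if "\<And>a e r. (a, e, r) \<in> K \<Longrightarrow> block_rank_le d Act (\<lambda>q. x (var_at q)) 0 a e r" for x
    proof (rule genideal_vanishes[OF F_carrier _ p(1), of "{x}"])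
      fix f y assume "f \<in> F" "y \<in> {x}"
      then obtain a e r rs cs where K: "(a, e, r) \<in> K" and f: "f = minor_at (Suc r) rs cs"
        "rs ` {..<Suc r} \<subseteq> {..<d}" "cs ` {..<Suc r} \<subseteq> {a..<e} \<inter> Act" and y: "y = x"
        unfolding F minors_on_def by blast
      have rank: "rank_le {0..<d} ({a..<e} \<inter> Act) (\<lambda>i c. x (var_at (c, i))) r"
        using that[OF K] unfolding block_rank_le_def .
      show "poly_value y f = 0"
        unfolding f(1) y poly_value_minor_at
        by (rule det_eq_0_if_rank_le[OF rank]) (use f(2,3) in auto)
    qed simp
    then obtain a e r rs cs l where K: "(a, e, r) \<in> K"
      and mono: "strict_mono_on {..<Suc r} rs" "strict_mono_on {..<Suc r} cs"
      and in_range: "rs ` {..<Suc r} \<subseteq> {..<d}" "cs ` {..<Suc r} \<subseteq> {a..<e} \<inter> Act"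
      and l: "Max (Poly_Mapping.keys p) = l + perm_monomial (Suc r) rs cs id"
      by (rule leading_monomial_above_minor[OF p_carrier p(2)])
    let ?f = "minor_at (Suc r) rs cs"
    have "?f \<in> F - {0}"
      using K mono in_range minor_at_leading(1)[OF mono] unfolding F minors_on_def by blast
    then have f_G: "initial_monomial ?f \<in> Idl\<^bsub>?R\<^esub> ?G" using genideal_self[OF G] by blast
    have "Max (Poly_Mapping.keys p) \<in> Poly_Mapping.keys p" using p(2) by (intro Max_in) auto
    then have "Poly_Mapping.keys (Max (Poly_Mapping.keys p)) \<subseteq> indets d k2"
      using p_carrier unfolding poly_ring_sel by blast
    then have "Poly_Mapping.keys l \<subseteq> indets d k2"
      unfolding l by (auto simp: in_keys_iff lookup_add subset_iff)
    then have "Poly_Mapping.single l 1 \<in> carrier ?R" unfolding poly_ring_sel by simp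
    then have "Poly_Mapping.single l 1 \<otimes>\<^bsub>?R\<^esub> initial_monomial ?f \<in> Idl\<^bsub>?R\<^esub> ?G"
      using ideal.I_l_closed[OF genideal_ideal[OF G] f_G] by blast
    then show ?thesis
      unfolding minor_at_leading(2)[OF mono] poly_ring_sel
      by (simp add: initial_monomial_def l mult_single)
  qed
  then have "Idl\<^bsub>?R\<^esub> (initial_monomial ` (?I - {0})) \<subseteq> Idl\<^bsub>?R\<^esub> ?G"
    by (intro genideal_minimal genideal_ideal G) auto
  moreover have "Idl\<^bsub>?R\<^esub> ?G \<subseteq> Idl\<^bsub>?R\<^esub> (initial_monomial ` (?I - {0}))"
    using F_I by (intro genideal_minimal genideal_ideal L subset_trans[OF _ genideal_self[OF L]]) auto
  ultimately show ?thesis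
    unfolding is_groebner_basis_def initial_ideal_def using fin F_I by blast
qed

section \<open>The ideal of a minimal set\<close>

theorem corollary4p5:
  fixes d k2 t u v :: nat and S :: "(nat \<times> nat) set"
  assumes "2 \<le> t" and "t \<le> min k2 d"
    and "S \<noteq> {}" and "S \<subseteq> {1..2} \<times> {1..k2}"
    and "minimal k2 t S"
    and "comb_type k2 S = (u, v)"
    and "S = {1} \<times> {1..u} \<union> {2} \<times> {k2 - v + 1..k2}"
  shows "is_groebner_basis (indets d k2) (F_J d k2 t S) (J_ideal d k2 t S)"
proof -
  note S = assms(7)
  have uv: "1 \<le> u" "u \<le> v" "v \<le> k2 - t + 1" and no_col: "\<forall>j\<in>{1..k2}. \<not> col_set j \<subseteq> S"
    using assms(5,6) unfolding minimal_def by auto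
  have "(1, u) \<in> S" using uv(1) unfolding S by simp
  then have "u \<le> k2" using assms(4) by auto
  have v_le: "v \<le> k2" using uv(3) assms(1,2) by (simp add: min_def split: if_splits)
  have uv_le: "u \<le> k2 - v"
  proof (rule ccontr)
    assume "\<not> ?thesis"
    then have "col_set u \<subseteq> S" unfolding S col_set_def using uv(1) \<open>u \<le> k2\<close> by (auto simp: le_Suc_eq)
    then show False using no_col uv(1) \<open>u \<le> k2\<close> by auto
  qed
  let ?q = "k2 - v"
  have free: "{j \<in> {1..k2}. col_set j \<inter> S = {}} = {u + 1..?q}"
  proof (intro equalityI subsetI)
    fix j assume "j \<in> {j \<in> {1..k2}. col_set j \<inter> S = {}}"
    moreover have "(1, j) \<in> col_set j" "(2, j) \<in> col_set j" unfolding col_set_def by auto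
    ultimately have "j \<in> {1..k2}" "(1, j) \<notin> S" "(2, j) \<notin> S" by auto
    then show "j \<in> {u + 1..?q}" unfolding S by auto
  next
    fix j assume "j \<in> {u + 1..?q}"
    then show "j \<in> {j \<in> {1..k2}. col_set j \<inter> S = {}}" unfolding S col_set_def by auto
  qed
  \<comment> \<open>The positions of the columns outside \<open>S\<close>: the even positions belong to \<open>R\<^sub>1\<close>, the odd ones to
    \<open>R\<^sub>2\<close>. The free pairs occupy the positions from \<open>2 * u\<close> to \<open>2 * (k2 - v) - 1\<close>.\<close>
  define Act where "Act = {c. c < 2 * k2 \<and> (even c \<longrightarrow> u \<le> c div 2) \<and> (odd c \<longrightarrow> c div 2 < ?q)}"
  have col_pos_eq: "col_pos ` U = C"
    if "\<And>c. c \<in> C \<longleftrightarrow> (c mod 2 + 1, c div 2 + 1) \<in> U" "U \<subseteq> {1..2} \<times> {1..k2}" for U C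
  proof (intro equalityI subsetI)
    fix c assume "c \<in> C"
    moreover have "col_pos (c mod 2 + 1, c div 2 + 1) = c" by (simp add: col_pos_def)
    ultimately show "c \<in> col_pos ` U" using that(1) by (metis imageI)
  next
    fix c assume "c \<in> col_pos ` U"
    then obtain j l where "(j, l) \<in> U" "c = col_pos (j, l)" by auto
    moreover from this have "1 \<le> l" "j = 1 \<or> j = 2" using that(2) by auto
    ultimately have "(c mod 2 + 1, c div 2 + 1) = (j, l)" by (auto simp: col_pos_def)
    then show "c \<in> C" using that(1) \<open>(j, l) \<in> U\<close> by simp
  qed
  have Act: "Act \<subseteq> {..<2 * k2}" unfolding Act_def by auto
  have free_cols: "free_cols k2 S = {1..2} \<times> {u + 1..?q}"
  proof -
    have "free_cols k2 S = (\<Union>j\<in>{u + 1..?q}. col_set j)"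
      unfolding free_cols_def free[symmetric] by blast
    then show ?thesis unfolding col_set_def by auto
  qed
  have two: "{1..2} \<times> B = {1} \<times> B \<union> {2 :: nat} \<times> B" for B :: "nat set" by auto
  have R1: "row_set k2 1 - S \<union> free_cols k2 S = {1} \<times> {u + 1..k2} \<union> {2} \<times> {u + 1..?q}"
  proof -
    have "row_set k2 1 - S = {1} \<times> {u + 1..k2}" unfolding S row_set_def by auto
    moreover have "{1} \<times> {u + 1..?q} \<subseteq> {1 :: nat} \<times> {u + 1..k2}" by auto
    ultimately show ?thesis unfolding free_cols two by blast
  qed
  have R2: "row_set k2 2 - S \<union> free_cols k2 S = {1} \<times> {u + 1..?q} \<union> {2} \<times> {1..?q}"
  proof -
    have "row_set k2 2 - S = {2} \<times> {1..?q}" unfolding S row_set_def by auto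
    moreover have "{2} \<times> {u + 1..?q} \<subseteq> {2 :: nat} \<times> {1..?q}" by auto
    ultimately show ?thesis unfolding free_cols two by blast
  qed
  have parity: "(\<exists>l. c = 2 * l) \<or> (\<exists>l. c = 2 * l + 1)" for c :: nat by presburger
  have M: "col_pos ` free_cols k2 S = {2 * u..<2 * ?q} \<inter> Act"
  proof (rule col_pos_eq)
    show "c \<in> {2 * u..<2 * ?q} \<inter> Act \<longleftrightarrow> (c mod 2 + 1, c div 2 + 1) \<in> free_cols k2 S" for c
      unfolding free_cols Act_def using parity[of c] by (elim disjE exE) auto
    show "free_cols k2 S \<subseteq> {1..2} \<times> {1..k2}" unfolding free_cols by auto
  qed
  have MB: "col_pos ` (row_set k2 1 - S \<union> free_cols k2 S) = {2 * u..<2 * k2} \<inter> Act"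
  proof (rule col_pos_eq)
    show "c \<in> {2 * u..<2 * k2} \<inter> Act \<longleftrightarrow>
      (c mod 2 + 1, c div 2 + 1) \<in> row_set k2 1 - S \<union> free_cols k2 S" for c
      unfolding R1 Act_def using parity[of c] by (elim disjE exE) auto
    show "row_set k2 1 - S \<union> free_cols k2 S \<subseteq> {1..2} \<times> {1..k2}" unfolding R1 by auto
  qed
  have AM: "col_pos ` (row_set k2 2 - S \<union> free_cols k2 S) = {0..<2 * ?q} \<inter> Act"
  proof (rule col_pos_eq)
    show "c \<in> {0..<2 * ?q} \<inter> Act \<longleftrightarrow>
      (c mod 2 + 1, c div 2 + 1) \<in> row_set k2 2 - S \<union> free_cols k2 S" for c
      unfolding R2 Act_def using parity[of c] by (elim disjE exE) auto
    show "row_set k2 2 - S \<union> free_cols k2 S \<subseteq> {1..2} \<times> {1..k2}" unfolding R2 by auto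
  qed
  have pair: "col_pos ` col_set j = {2 * (j - 1)..<2 * (j - 1) + 2} \<inter> Act" if "j \<in> {u + 1..?q}" for j
  proof (rule col_pos_eq)
    show "c \<in> {2 * (j - 1)..<2 * (j - 1) + 2} \<inter> Act \<longleftrightarrow> (c mod 2 + 1, c div 2 + 1) \<in> col_set j" for c
      unfolding col_set_def Act_def using that parity[of c] by (elim disjE exE) auto
  qed (use that in \<open>auto simp: col_set_def\<close>)
  define K where "K = (\<lambda>j. (2 * (j - 1), 2 * (j - 1) + 2, 1)) ` {u + 1..?q} \<union>
    {(2 * u, 2 * ?q, t - 2), (2 * u, 2 * k2, t - 1), (0, 2 * ?q, t - 1)}"
  have "F_J d k2 t S = (\<Union>(a, e, r)\<in>K. minors_on d ({a..<e} \<inter> Act) (Suc r))"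
  proof -
    have minors_eq: "minors r (cols_submatrix d k2 U) = minors_on d ({a..<e} \<inter> Act) r"
      if "col_pos ` U = {a..<e} \<inter> Act" for r U a e
      using that by (rule minors_cols_submatrix) (use Act in auto)
    have pairs: "(\<Union>j\<in>{u + 1..?q}. minors 2 (cols_submatrix d k2 (col_set j))) =
        (\<Union>j\<in>{u + 1..?q}. minors_on d ({2 * (j - 1)..<2 * (j - 1) + 2} \<inter> Act) 2)"
      by (intro SUP_cong refl minors_eq pair)
    have "Suc 1 = 2" "Suc (t - 2) = t - 1" "Suc (t - 1) = t" using assms(1) by auto
    then have "(\<Union>(a, e, r)\<in>K. minors_on d ({a..<e} \<inter> Act) (Suc r)) =
        (\<Union>j\<in>{u + 1..?q}. minors_on d ({2 * (j - 1)..<2 * (j - 1) + 2} \<inter> Act) 2) \<union>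
        minors_on d ({2 * u..<2 * ?q} \<inter> Act) (t - 1) \<union> minors_on d ({2 * u..<2 * k2} \<inter> Act) t \<union>
        minors_on d ({0..<2 * ?q} \<inter> Act) t"
      unfolding K_def by (simp add: Un_ac numeral_2_eq_2)
    then show ?thesis
      unfolding F_J_def free pairs minors_eq[OF M] minors_eq[OF MB] minors_eq[OF AM] by (rule sym)
  qed
  moreover have "finite (F_J d k2 t S)"
    unfolding F_J_def by (intro finite_UnI finite_UN_I finite_minors) auto
  ultimately show ?thesis unfolding J_ideal_def by (intro interval_minors_groebner[OF Act])
qed

end
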